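(* Suppose that the comparison graph comes from an Erdős–Rényi graph $ER(n,p)$. Let $\boldsymbol\theta^*\in\mathbb R^n$ be the BTL parameter, $\kappa=\max_{i,j}|\theta_i^*-\theta_j^*|$ and $\kappa_E=\max_{(i,j)\in E}|\theta_i^*-\theta_j^*|$. Assume that $\mathbf 1_n^\top\boldsymbol\theta^*=0$, $\kappa\le n$, $\kappa_E\le\log n$, $L\le n^8e^{4\kappa_E}\max\{1,\kappa\}$, $np>C_1\log n$, and $L\ge C_2\max\{1,\kappa\}e^{4\kappa_E}n/\log^2n$ for some sufficiently large constants $C_1,C_2>0$. Set $\rho=\frac{c_\rho}{\kappa}\sqrt{n_{\max}/L}$. Then $\mathbf 1_n^\top\hat{\boldsymbol\theta}_\rho=0$, and with probability at least $1-O(n^{-4})$ it holds that $$\|\hat{\boldsymbol\theta}_\rho-\boldsymbol\theta^*\|_\infty\lesssim e^{2\kappa_E}\sqrt{\frac1{np^2L}}+e^{\kappa_E}\sqrt{\frac{\log n}{npL}},\qquad \|\hat{\boldsymbol\theta}_\rho-\boldsymbol\theta^*\|_2\lesssim e^{\kappa_E}\sqrt{\frac1{pL}}.$$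
   Context: The comparison graph $([n],E)$ is an undirected simple graph on $[n]=\{1,\dots,n\}$ with adjacency matrix $A_{ij}=1\{(i,j)\in E\}$; here it is random, each pair being an edge independently with probability $p$. $n_{\max}$ is its maximum degree. BTL model: given the graph, for each edge $(i,j)\in E$, $i<j$, one observes $L$ independent outcomes $y_{ij}^{(l)}\in\{0,1\}$ with $\Pr(y_{ij}^{(l)}=1)=\psi(\theta_i^*-\theta_j^* )$, where $\psi(t)=1/(1+e^{-t})$; all comparisons are independent. Put $\bar y_{ij}=\frac1L\sum_{l=1}^Ly_{ij}^{(l)}$. The negative log-likelihood is $$\ell(\boldsymbol\theta;\mathbf y)=-\sum_{1\le i<j\le n}A_{ij}\left\{\bar y_{ij}\log\psi(\theta_i-\theta_j)+(1-\bar y_{ij})\log[1-\psi(\theta_i-\theta_j)]\right\},$$ and the regularized MLE is $\hat{\boldsymbol\theta}_\rho=\arg\min_{\mathbf 1_n^\top\boldsymbol\theta=0}\left\{\ell(\boldsymbol\theta;\mathbf y)+\frac\rho2\|\boldsymbol\theta\|_2^2\right\}$. $\mathbf 1_n$ is the all-ones vector; $c_\rho>0$ is a fixed constant; $x\lesssim y$ means $x\le cy$ for a constant $c>0$ not depending on $n,p,L,\boldsymbol\theta^*$; likewise for $O(\cdot)$. *)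

theory Defs
  imports "HOL-Probability.Probability"
begin

text \<open>
  A vector in $R^n$ is a function \<open>nat \<Rightarrow> real\<close> of which only the values on \<open>{1..n}\<close> matter.
  A simple graph on \<open>{1..n}\<close> is given by its set of edges, each a two-element subset of \<open>{1..n}\<close>;
  in particular \<open>{i, i}\<close> is never an edge.
\<close>

definition vertex_pairs :: "nat \<Rightarrow> nat set set" where
  "vertex_pairs n = {e. e \<subseteq> {1..n} \<and> card e = 2}"

definition erdos_renyi :: "nat \<Rightarrow> real \<Rightarrow> nat set set pmf" where
  "erdos_renyi n p =
     map_pmf (\<lambda>b. {e \<in> vertex_pairs n. b e})
       (Pi_pmf (vertex_pairs n) False (\<lambda>_. bernoulli_pmf p))"

definition adj :: "nat set set \<Rightarrow> nat \<Rightarrow> nat \<Rightarrow> real" where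
  "adj E i j = of_bool ({i, j} \<in> E)"

definition max_degree :: "nat \<Rightarrow> nat set set \<Rightarrow> nat" where
  "max_degree n E = Max ((\<lambda>i. card {j \<in> {1..n}. {i, j} \<in> E}) ` {1..n})"

definition psi :: "real \<Rightarrow> real" where
  "psi t = 1 / (1 + exp (- t))"

text \<open>
  The outcome \<open>y (i, j, l)\<close> is only observed when \<open>i < j\<close>, \<open>{i, j}\<close> is an edge and \<open>l \<in> {1..L}\<close>;
  elsewhere it is the dummy value \<open>False\<close>.
\<close>

type_synonym outcomes = "nat \<times> nat \<times> nat \<Rightarrow> bool"

definition comparisons :: "nat \<Rightarrow> nat \<Rightarrow> nat set set \<Rightarrow> (nat \<times> nat \<times> nat) set" where
  "comparisons n L E =
     {(i, j, l). i \<in> {1..n} \<and> j \<in> {1..n} \<and> i < j \<and> {i, j} \<in> E \<and> l \<in> {1..L}}"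

definition btl_outcomes :: "nat \<Rightarrow> nat \<Rightarrow> (nat \<Rightarrow> real) \<Rightarrow> nat set set \<Rightarrow> outcomes pmf" where
  "btl_outcomes n L \<theta> E =
     Pi_pmf (comparisons n L E) False (\<lambda>(i, j, l). bernoulli_pmf (psi (\<theta> i - \<theta> j)))"

definition btl_data ::
    "nat \<Rightarrow> real \<Rightarrow> nat \<Rightarrow> (nat \<Rightarrow> real) \<Rightarrow> (nat set set \<times> outcomes) pmf" where
  "btl_data n p L \<theta> =
     bind_pmf (erdos_renyi n p) (\<lambda>E. map_pmf (Pair E) (btl_outcomes n L \<theta> E))"

definition ybar :: "nat \<Rightarrow> outcomes \<Rightarrow> nat \<Rightarrow> nat \<Rightarrow> real" where
  "ybar L y i j = (\<Sum>l = 1..L. of_bool (y (i, j, l))) / real L"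

definition neg_log_lik ::
    "nat \<Rightarrow> nat \<Rightarrow> nat set set \<Rightarrow> outcomes \<Rightarrow> (nat \<Rightarrow> real) \<Rightarrow> real" where
  "neg_log_lik n L E y \<theta> =
     - (\<Sum>(i, j) \<in> {(i, j). 1 \<le> i \<and> i < j \<and> j \<le> n}.
          adj E i j * (ybar L y i j * ln (psi (\<theta> i - \<theta> j))
                       + (1 - ybar L y i j) * ln (1 - psi (\<theta> i - \<theta> j))))"

text \<open>The extensional function space makes the coordinates outside \<open>{1..n}\<close> irrelevant.\<close>

definition reg_mle ::
    "nat \<Rightarrow> nat \<Rightarrow> real \<Rightarrow> nat set set \<Rightarrow> outcomes \<Rightarrow> nat \<Rightarrow> real" where
  "reg_mle n L \<rho> E y =
     arg_min (\<lambda>\<theta>. neg_log_lik n L E y \<theta> + \<rho> / 2 * (L2_set \<theta> {1..n})\<^sup>2)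
       (\<lambda>\<theta>. \<theta> \<in> {1..n} \<rightarrow>\<^sub>E UNIV \<and> (\<Sum>i = 1..n. \<theta> i) = 0)"

definition Linf_norm :: "nat \<Rightarrow> (nat \<Rightarrow> real) \<Rightarrow> real" where
  "Linf_norm n x = Max ((\<lambda>i. \<bar>x i\<bar>) ` {1..n})"

definition kappa :: "nat \<Rightarrow> (nat \<Rightarrow> real) \<Rightarrow> real" where
  "kappa n \<theta> = Max {\<bar>\<theta> i - \<theta> j\<bar> | i j. i \<in> {1..n} \<and> j \<in> {1..n}}"

text \<open>Inserting \<open>0\<close> only matters for the graph without edges.\<close>

definition kappa_E :: "nat set set \<Rightarrow> (nat \<Rightarrow> real) \<Rightarrow> real" where
  "kappa_E E \<theta> = Max (insert 0 {\<bar>\<theta> i - \<theta> j\<bar> | i j. {i, j} \<in> E})"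

definition rho :: "real \<Rightarrow> nat \<Rightarrow> nat \<Rightarrow> (nat \<Rightarrow> real) \<Rightarrow> nat set set \<Rightarrow> real" where
  "rho c_rho n L \<theta> E = c_rho / kappa n \<theta> * sqrt (real (max_degree n E) / real L)"

end

theory Submission
  imports Defs
begin

text \<open>
  The proof separates a property of the graph, a property of the noise, and a deterministic
  argument that turns the two into the error bounds.

  \<^emph>\<open>Graph.\<close> By Chernoff bounds and a union bound over vertex sets, with probability
  \<open>1 - O(n ^ -4)\<close> every cut of the random graph has at least half of its expected number of edges
  and no degree exceeds \<open>3 n p\<close>. By Cheeger's inequality this expansion forces
  \<open>\<Sum>a b. A\<^sub>a\<^sub>b (x\<^sub>a - x\<^sub>b)\<^sup>2 \<ge> (n p / 48) \<parallel>x\<parallel>\<^sup>2\<close> for centred \<open>x\<close>. Only the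
  order \<open>n p\<close> of the spectral gap matters, so the quadratic loss in Cheeger's inequality is
  harmless: relative to the degrees, the expansion is bounded below by a constant. Lemmas
  \<open>erdos_renyi_expanding\<close> and \<open>cheeger_inequality\<close> carry this part.

  \<^emph>\<open>Noise.\<close> Given the graph, the gradient \<open>g\<close> of the negative log-likelihood at the true
  parameter is a linear image of independent centred Bernoulli variables, and Hoeffding's lemma
  gives \<open>E exp \<langle>u, g\<rangle> \<le> exp (D \<parallel>u\<parallel>\<^sup>2 / (4 L))\<close> when all degrees are at most \<open>D\<close>. This
  bounds each coordinate of \<open>g\<close> by \<open>O(sqrt (n p log n / L))\<close>. It also bounds \<open>\<parallel>g\<parallel>\<^sub>2\<close> by
  \<open>O(sqrt (n \<cdot> n p / L))\<close>, without a logarithm: averaging the bound over a Gaussian vector \<open>u\<close>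
  turns it into an exponential moment of \<open>\<parallel>g\<parallel>\<^sup>2\<close>. The regularisation adds \<open>\<rho> \<theta>\<^sub>i\<close> to the
  \<open>i\<close>-th coordinate, and \<open>\<bar>\<theta>\<^sub>i\<bar> \<le> \<kappa>\<close> together with the choice of \<open>\<rho>\<close> makes this
  \<open>O(sqrt (n p / L))\<close>, which both noise bounds absorb. Lemmas
  \<open>score_mgf\<close> and \<open>subgaussian_square_mgf\<close> carry this part.

  \<^emph>\<open>Error bounds.\<close> Let \<open>\<Delta>\<close> be the error and suppose that all its coordinates are at most
  \<open>1\<close> in absolute value. Then the score equation is a weighted Laplacian system in \<open>\<Delta>\<close>, with
  weights between a constant times \<open>exp (- \<kappa>\<^sub>E)\<close> and \<open>1 / 4\<close> on the edges. Testing it with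
  \<open>\<Delta>\<close> and using the spectral gap gives the Euclidean bound. Its \<open>i\<close>-th coordinate gives the
  maximum-norm bound: the neighbours of \<open>i\<close> contribute at most
  \<open>sqrt (degree) \<parallel>\<Delta>\<parallel>\<^sub>2 / 4\<close>, and the diagonal coefficient is at least of order
  \<open>n p exp (- \<kappa>\<^sub>E)\<close>. This is where the first term of the maximum-norm bound comes from.

  The assumption on \<open>L\<close> makes the resulting bound on \<open>\<bar>\<Delta>\<^sub>i\<bar>\<close> at most \<open>1 / 2\<close>, so the bound
  \<open>1\<close> that was supposed improves itself. To get it in the first place, the estimator is joined to the
  true parameter by the minimisers for the data \<open>(1 - t) \<psi>\<^sup>* + t y\<close> and the regularisation
  centre \<open>(1 - t) \<theta>\<^sup>*\<close>, where \<open>0 \<le> t \<le> 1\<close>. At \<open>t = 0\<close> the minimiser is \<open>\<theta>\<^sup>*\<close>, at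
  \<open>t = 1\<close> it is the estimator, and since the loss is \<open>\<rho>\<close>-strongly convex the path is Lipschitz in
  \<open>t\<close>. It therefore cannot jump from distance \<open>1 / 2\<close> to a distance above \<open>1\<close>. Lemmas
  \<open>path_local_bound\<close> and \<open>path_endpoint_bound\<close> are the core of this argument.
\<close>

section \<open>Expansion and spectral gap\<close>

text \<open>
  The discrete co-area formula. Subtracting from \<open>F\<close> its smallest positive value \<open>\<mu>\<close> on the
  support \<open>S\<close> lowers the right-hand side by \<open>2 \<mu>\<close> times the size of the cut of \<open>S\<close>, and lowers
  \<open>\<Sum>F\<close> by \<open>\<mu> \<cdot> card S\<close>. The support shrinks, so induction on its size applies.
\<close>
lemma cheeger_coarea:
  fixes A :: "'a \<Rightarrow> 'a \<Rightarrow> real" and F :: "'a \<Rightarrow> real"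
  assumes fin: "finite V" and sym: "\<And>a b. A a b = A b a" and nonneg: "\<And>a b. A a b \<ge> 0"
    and cut: "\<And>S. S \<subseteq> V \<Longrightarrow> S \<noteq> {} \<Longrightarrow> 2 * card S \<le> card V \<Longrightarrow>
                h * real (card S) \<le> (\<Sum>a\<in>S. \<Sum>b\<in>V - S. A a b)"
    and F0: "\<And>v. v \<in> V \<Longrightarrow> F v \<ge> 0"
    and supp: "2 * card {v \<in> V. F v > 0} \<le> card V"
  shows "2 * h * (\<Sum>v\<in>V. F v) \<le> (\<Sum>a\<in>V. \<Sum>b\<in>V. A a b * \<bar>F a - F b\<bar>)"
  using F0 supp
proof (induction "card {v \<in> V. F v > 0}" arbitrary: F rule: less_induct)
  case less
  define S where "S = {v \<in> V. F v > 0}"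
  have S: "S \<subseteq> V" "finite S" using fin by (auto simp: S_def)
  show ?case
  proof (cases "S = {}")
    case True
    hence "F v = 0" if "v \<in> V" for v using less.prems(1)[OF that] that by (force simp: S_def)
    thus ?thesis by simp
  next
    case False
    define \<mu> where "\<mu> = Min (F ` S)"
    have "\<mu> \<in> F ` S" using False S by (simp add: \<mu>_def)
    then obtain s where s: "s \<in> S" "\<mu> = F s" by auto
    have \<mu>pos: "\<mu> > 0" using s by (simp add: S_def)
    have \<mu>le: "\<mu> \<le> F v" if "v \<in> S" for v using that S by (simp add: \<mu>_def)
    define G where "G v = (if v \<in> S then F v - \<mu> else F v)" for v
    have F_out: "F v = 0" if "v \<in> V - S" for v
      using less.prems(1)[of v] that by (force simp: S_def)
    have G_pos: "{v \<in> V. G v > 0} \<subset> S"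
      using s F_out S by (force simp: G_def)
    hence card_less: "card {v \<in> V. G v > 0} < card {v \<in> V. F v > 0}"
      using S psubset_card_mono unfolding S_def[symmetric] by blast
    have IH: "2 * h * (\<Sum>v\<in>V. G v) \<le> (\<Sum>a\<in>V. \<Sum>b\<in>V. A a b * \<bar>G a - G b\<bar>)"
    proof (rule less.hyps[OF card_less])
      show "G v \<ge> 0" if "v \<in> V" for v
        using less.prems(1)[OF that] \<mu>le by (auto simp: G_def)
      show "2 * card {v \<in> V. G v > 0} \<le> card V"
        using card_less less.prems(2) by linarith
    qed
    have sumF: "(\<Sum>v\<in>V. F v) = (\<Sum>v\<in>V. G v) + \<mu> * real (card S)"
    proof -
      have "(\<Sum>v\<in>V. F v) = (\<Sum>v\<in>V. G v + (if v \<in> S then \<mu> else 0))"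
        by (intro sum.cong) (auto simp: G_def)
      also have "\<dots> = (\<Sum>v\<in>V. G v) + (\<Sum>v\<in>V. if v \<in> S then \<mu> else 0)"
        by (simp add: sum.distrib)
      also have "(\<Sum>v\<in>V. if v \<in> S then \<mu> else 0) = (\<Sum>v\<in>V \<inter> S. \<mu>)"
        using fin by (simp only: sum.inter_restrict)
      also have "V \<inter> S = S" using S by auto
      finally show ?thesis by simp
    qed
    let ?c = "\<Sum>a\<in>S. \<Sum>b\<in>V - S. A a b"
    have "(\<Sum>a\<in>V. \<Sum>b\<in>V. A a b * \<bar>F a - F b\<bar>) =
      (\<Sum>a\<in>V. \<Sum>b\<in>V. A a b * \<bar>G a - G b\<bar> + \<mu> * (if a \<in> S \<and> b \<in> V - S then A a b else 0)
        + \<mu> * (if b \<in> S \<and> a \<in> V - S then A b a else 0))"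
    proof (intro sum.cong refl)
      fix a b assume ab: "a \<in> V" "b \<in> V"
      show "A a b * \<bar>F a - F b\<bar> = A a b * \<bar>G a - G b\<bar> + \<mu> * (if a \<in> S \<and> b \<in> V - S then A a b else 0)
        + \<mu> * (if b \<in> S \<and> a \<in> V - S then A b a else 0)"
      proof -
        consider "a \<in> S" "b \<in> S" | "a \<in> S" "b \<notin> S" | "a \<notin> S" "b \<in> S" | "a \<notin> S" "b \<notin> S" by blast
        then show ?thesis
        proof cases
          case 1 thus ?thesis by (simp add: G_def)
        next
          case 2
          hence "F b = 0" using F_out ab by simp
          thus ?thesis using 2 ab \<mu>le[of a] \<mu>pos by (simp add: G_def algebra_simps)
        next
          case 3
          hence "F a = 0" using F_out ab by simp
          thus ?thesis using 3 ab \<mu>le[of b] \<mu>pos by (simp add: G_def algebra_simps sym[of a b])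
        next
          case 4 thus ?thesis by (simp add: G_def)
        qed
      qed
    qed
    also have "\<dots> = (\<Sum>a\<in>V. \<Sum>b\<in>V. A a b * \<bar>G a - G b\<bar>)
       + \<mu> * (\<Sum>a\<in>V. \<Sum>b\<in>V. if a \<in> S \<and> b \<in> V - S then A a b else 0)
       + \<mu> * (\<Sum>b\<in>V. \<Sum>a\<in>V. if b \<in> S \<and> a \<in> V - S then A b a else 0)"
      by (subst sum.swap[of "\<lambda>b a. if b \<in> S \<and> a \<in> V - S then A b a else 0"])
        (simp add: sum.distrib sum_distrib_left)
    also have "(\<Sum>a\<in>V. \<Sum>b\<in>V. if a \<in> S \<and> b \<in> V - S then A a b else 0) = ?c"
    proof -
      have "(\<Sum>a\<in>V. \<Sum>b\<in>V. if a \<in> S \<and> b \<in> V - S then A a b else 0)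
          = (\<Sum>a\<in>V. if a \<in> S then (\<Sum>b\<in>V. if b \<in> V - S then A a b else 0) else 0)"
        by (intro sum.cong) auto
      also have "\<dots> = (\<Sum>a\<in>V \<inter> S. \<Sum>b\<in>V \<inter> (V - S). A a b)"
        using fin by (simp only: sum.inter_restrict)
      also have "V \<inter> S = S" using S by auto
      also have "V \<inter> (V - S) = V - S" by auto
      finally show ?thesis .
    qed
    finally have sumA: "(\<Sum>a\<in>V. \<Sum>b\<in>V. A a b * \<bar>F a - F b\<bar>) =
       (\<Sum>a\<in>V. \<Sum>b\<in>V. A a b * \<bar>G a - G b\<bar>) + 2 * (\<mu> * ?c)" by simp
    have "h * real (card S) \<le> ?c"
      using cut[of S] S False less.prems(2) by (simp add: S_def)
    hence "\<mu> * (h * real (card S)) \<le> \<mu> * ?c" using \<mu>pos by (intro mult_left_mono) auto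
    thus ?thesis using IH unfolding sumF sumA by (simp add: algebra_simps)
  qed
qed

text \<open>
  The co-area bound for \<open>f\<^sup>2\<close>, combined with Cauchy--Schwarz for the factorisation
  \<open>f\<^sub>a\<^sup>2 - f\<^sub>b\<^sup>2 = (f\<^sub>a - f\<^sub>b) (f\<^sub>a + f\<^sub>b)\<close>.
\<close>
lemma cheeger_half:
  fixes A :: "'a \<Rightarrow> 'a \<Rightarrow> real" and f :: "'a \<Rightarrow> real"
  assumes fin: "finite V" and sym: "\<And>a b. A a b = A b a" and nonneg: "\<And>a b. A a b \<ge> 0"
    and cut: "\<And>S. S \<subseteq> V \<Longrightarrow> S \<noteq> {} \<Longrightarrow> 2 * card S \<le> card V \<Longrightarrow>
                h * real (card S) \<le> (\<Sum>a\<in>S. \<Sum>b\<in>V - S. A a b)"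
    and deg: "\<And>a. a \<in> V \<Longrightarrow> (\<Sum>b\<in>V. A a b) \<le> D" and D: "D > 0" and h: "h \<ge> 0"
    and f0: "\<And>v. v \<in> V \<Longrightarrow> f v \<ge> 0"
    and supp: "2 * card {v \<in> V. f v > 0} \<le> card V"
  shows "h\<^sup>2 / D * (\<Sum>v\<in>V. (f v)\<^sup>2) \<le> (\<Sum>a\<in>V. \<Sum>b\<in>V. A a b * (f a - f b)\<^sup>2)" (is "_ \<le> ?E")
proof -
  define N where "N = (\<Sum>v\<in>V. (f v)\<^sup>2)"
  have N0: "N \<ge> 0" by (simp add: N_def sum_nonneg)
  have E0: "?E \<ge> 0" by (intro sum_nonneg) (simp add: nonneg)
  have "2 * h * N \<le> (\<Sum>a\<in>V. \<Sum>b\<in>V. A a b * \<bar>(f a)\<^sup>2 - (f b)\<^sup>2\<bar>)"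
    unfolding N_def
  proof (rule cheeger_coarea[OF fin sym nonneg cut])
    have "{v \<in> V. (f v)\<^sup>2 > 0} = {v \<in> V. f v > 0}" using f0 by (force simp: order_less_le)
    thus "2 * card {v \<in> V. (f v)\<^sup>2 > 0} \<le> card V" using supp by simp
  qed auto
  hence "(2 * h * N)\<^sup>2 \<le> (\<Sum>a\<in>V. \<Sum>b\<in>V. A a b * \<bar>(f a)\<^sup>2 - (f b)\<^sup>2\<bar>)\<^sup>2"
    using N0 h by (intro power_mono) auto
  also have "(\<Sum>a\<in>V. \<Sum>b\<in>V. A a b * \<bar>(f a)\<^sup>2 - (f b)\<^sup>2\<bar>) =
     (\<Sum>(a,b)\<in>V\<times>V. (sqrt (A a b) * \<bar>f a - f b\<bar>) * (sqrt (A a b) * \<bar>f a + f b\<bar>))"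
    unfolding sum.cartesian_product
  proof (intro sum.cong refl, clarify)
    fix a b
    have "(f a)\<^sup>2 - (f b)\<^sup>2 = (f a - f b) * (f a + f b)" by (simp add: power2_eq_square algebra_simps)
    hence "A a b * \<bar>(f a)\<^sup>2 - (f b)\<^sup>2\<bar> = (sqrt (A a b) * sqrt (A a b)) * (\<bar>f a - f b\<bar> * \<bar>f a + f b\<bar>)"
      using nonneg[of a b] by (simp add: abs_mult)
    thus "A a b * \<bar>(f a)\<^sup>2 - (f b)\<^sup>2\<bar> = (sqrt (A a b) * \<bar>f a - f b\<bar>) * (sqrt (A a b) * \<bar>f a + f b\<bar>)"
      by (simp add: algebra_simps)
  qed
  also have "(\<Sum>(a,b)\<in>V\<times>V. (sqrt (A a b) * \<bar>f a - f b\<bar>) * (sqrt (A a b) * \<bar>f a + f b\<bar>))\<^sup>2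
     \<le> (\<Sum>(a,b)\<in>V\<times>V. (sqrt (A a b) * \<bar>f a - f b\<bar>)\<^sup>2) * (\<Sum>(a,b)\<in>V\<times>V. (sqrt (A a b) * \<bar>f a + f b\<bar>)\<^sup>2)"
    using Cauchy_Schwarz_ineq_sum[of "\<lambda>(a,b). sqrt (A a b) * \<bar>f a - f b\<bar>"
        "\<lambda>(a,b). sqrt (A a b) * \<bar>f a + f b\<bar>" "V \<times> V"] by (simp add: case_prod_unfold)
  also have "(\<Sum>(a,b)\<in>V\<times>V. (sqrt (A a b) * \<bar>f a - f b\<bar>)\<^sup>2) = ?E"
    by (simp add: sum.cartesian_product power_mult_distrib nonneg)
  also have "(\<Sum>(a,b)\<in>V\<times>V. (sqrt (A a b) * \<bar>f a + f b\<bar>)\<^sup>2) \<le> 4 * D * N"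
  proof -
    have "(\<Sum>(a,b)\<in>V\<times>V. (sqrt (A a b) * \<bar>f a + f b\<bar>)\<^sup>2)
      = (\<Sum>a\<in>V. \<Sum>b\<in>V. A a b * (f a + f b)\<^sup>2)"
      by (simp add: sum.cartesian_product power_mult_distrib nonneg)
    also have "\<dots> \<le> (\<Sum>a\<in>V. \<Sum>b\<in>V. A a b * (2 * (f a)\<^sup>2) + A b a * (2 * (f b)\<^sup>2))"
    proof (intro sum_mono)
      fix a b
      have "(f a + f b)\<^sup>2 \<le> 2 * (f a)\<^sup>2 + 2 * (f b)\<^sup>2"
        using zero_le_power2[of "f a - f b"] by (simp add: power2_eq_square algebra_simps)
      thus "A a b * (f a + f b)\<^sup>2 \<le> A a b * (2 * (f a)\<^sup>2) + A b a * (2 * (f b)\<^sup>2)"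
        using mult_left_mono[OF \<open>(f a + f b)\<^sup>2 \<le> _\<close> nonneg[of a b]] sym[of a b]
        by (simp add: ring_distribs)
    qed
    also have "\<dots> = (\<Sum>a\<in>V. \<Sum>b\<in>V. A a b * (2 * (f a)\<^sup>2)) + (\<Sum>b\<in>V. \<Sum>a\<in>V. A b a * (2 * (f b)\<^sup>2))"
      by (subst sum.swap[of "\<lambda>b a. A b a * (2 * (f b)\<^sup>2)"]) (simp add: sum.distrib)
    also have "\<dots> = 4 * (\<Sum>a\<in>V. (\<Sum>b\<in>V. A a b) * (f a)\<^sup>2)"
      by (simp add: sum_distrib_left sum_distrib_right algebra_simps)
    also have "\<dots> \<le> 4 * (\<Sum>a\<in>V. D * (f a)\<^sup>2)"
      by (intro mult_left_mono sum_mono mult_right_mono deg) auto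
    finally show ?thesis by (simp add: N_def sum_distrib_left algebra_simps)
  qed
  finally have *: "(2 * h * N)\<^sup>2 \<le> ?E * (4 * D * N)" using E0 by (simp add: mult_left_mono)
  show ?thesis
  proof (cases "N = 0")
    case True thus ?thesis using E0 unfolding N_def by simp
  next
    case False
    hence "N > 0" using N0 by simp
    have "N * (h\<^sup>2 * N) \<le> N * (?E * D)" using * by (simp add: power2_eq_square algebra_simps)
    hence "h\<^sup>2 * N \<le> ?E * D" using \<open>N > 0\<close> by (rule mult_left_le_imp_le)
    thus ?thesis using D unfolding N_def by (simp add: field_simps)
  qed
qed

lemma median_exists:
  fixes x :: "'a \<Rightarrow> real"
  assumes fin: "finite V" and ne: "V \<noteq> {}"
  obtains m where "2 * card {v \<in> V. x v > m} \<le> card V" "2 * card {v \<in> V. x v < m} \<le> card V"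
proof -
  \<comment> \<open>The median is the least value that has at most half of the values above it.\<close>
  define M where "M = {t \<in> x ` V. 2 * card {v \<in> V. x v > t} \<le> card V}"
  have "Max (x ` V) \<in> M"
  proof -
    have "{v \<in> V. x v > Max (x ` V)} = {}" using fin by (auto simp: not_less)
    thus ?thesis unfolding M_def using fin ne by (simp del: Collect_empty_eq)
  qed
  hence Mne: "M \<noteq> {}" and Mfin: "finite M" using fin by (auto simp: M_def)
  define m where "m = Min M"
  have mM: "m \<in> M" using Mne Mfin by (simp add: m_def)
  have "2 * card {v \<in> V. x v < m} \<le> card V"
  proof (cases "{v \<in> V. x v < m} = {}")
    case True thus ?thesis by (simp del: Collect_empty_eq)
  next
    case False
    define t where "t = Max (x ` {v \<in> V. x v < m})"
    have "t \<in> x ` {v \<in> V. x v < m}" unfolding t_def using fin False by (intro Max_in) auto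
    hence t: "t \<in> x ` V" "t < m" by auto
    have tmax: "x v \<le> t" if "v \<in> V" "x v < m" for v
      unfolding t_def using that fin by (intro Max_ge) auto
    have "t \<notin> M" using t Mfin unfolding m_def by (meson Min_le leD)
    hence "2 * card {v \<in> V. x v > t} > card V" using t by (simp add: M_def)
    moreover have "{v \<in> V. x v > t} = V - {v \<in> V. x v < m}" using t tmax by force
    moreover have "card (V - {v \<in> V. x v < m}) = card V - card {v \<in> V. x v < m}"
      using fin by (intro card_Diff_subset) auto
    ultimately have "2 * (card V - card {v \<in> V. x v < m}) > card V" by simp
    thus ?thesis by linarith
  qed
  with mM that show ?thesis by (auto simp: M_def)
qed

text \<open>
  The hard direction of Cheeger's inequality. The bound on cuts only concerns sets of at most half of
  the vertices, so \<open>x\<close> is split at a median into two nonnegative functions with small support.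
  Recentring at the median does not decrease \<open>\<Sum>x\<^sup>2\<close>, because \<open>x\<close> has mean zero.
\<close>
lemma cheeger_inequality:
  fixes A :: "'a \<Rightarrow> 'a \<Rightarrow> real" and x :: "'a \<Rightarrow> real"
  assumes fin: "finite V" and sym: "\<And>a b. A a b = A b a" and nonneg: "\<And>a b. A a b \<ge> 0"
    and cut: "\<And>S. S \<subseteq> V \<Longrightarrow> S \<noteq> {} \<Longrightarrow> 2 * card S \<le> card V \<Longrightarrow>
                h * real (card S) \<le> (\<Sum>a\<in>S. \<Sum>b\<in>V - S. A a b)"
    and deg: "\<And>a. a \<in> V \<Longrightarrow> (\<Sum>b\<in>V. A a b) \<le> D" and D: "D > 0" and h: "h \<ge> 0"
    and sum0: "(\<Sum>v\<in>V. x v) = 0"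
  shows "h\<^sup>2 / D * (\<Sum>v\<in>V. (x v)\<^sup>2) \<le> (\<Sum>a\<in>V. \<Sum>b\<in>V. A a b * (x a - x b)\<^sup>2)"
proof (cases "V = {}")
  case False
  obtain m where m: "2 * card {v \<in> V. x v > m} \<le> card V" "2 * card {v \<in> V. x v < m} \<le> card V"
    using median_exists[OF fin False] by blast
  define f where "f v = max (x v - m) 0" for v
  define g where "g v = max (m - x v) 0" for v
  have f: "h\<^sup>2 / D * (\<Sum>v\<in>V. (f v)\<^sup>2) \<le> (\<Sum>a\<in>V. \<Sum>b\<in>V. A a b * (f a - f b)\<^sup>2)"
    using m by (intro cheeger_half[OF fin sym nonneg cut deg D h])
      (auto simp: f_def less_max_iff_disj)
  have g: "h\<^sup>2 / D * (\<Sum>v\<in>V. (g v)\<^sup>2) \<le> (\<Sum>a\<in>V. \<Sum>b\<in>V. A a b * (g a - g b)\<^sup>2)"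
    using m by (intro cheeger_half[OF fin sym nonneg cut deg D h])
      (auto simp: g_def less_max_iff_disj)
  have fg: "(f v)\<^sup>2 + (g v)\<^sup>2 = (x v - m)\<^sup>2" for v
    by (auto simp: f_def g_def max_def power2_commute)
  have "(\<Sum>v\<in>V. (x v)\<^sup>2) \<le> (\<Sum>v\<in>V. (x v)\<^sup>2 + m\<^sup>2) - 2 * m * (\<Sum>v\<in>V. x v)"
    by (simp add: sum0 sum.distrib)
  also have "\<dots> = (\<Sum>v\<in>V. (x v - m)\<^sup>2)"
    unfolding sum_distrib_left sum_subtractf[symmetric]
    by (intro sum.cong) (auto simp: power2_eq_square algebra_simps)
  also have "\<dots> = (\<Sum>v\<in>V. (f v)\<^sup>2) + (\<Sum>v\<in>V. (g v)\<^sup>2)" by (simp add: sum.distrib flip: fg)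
  finally have "h\<^sup>2 / D * (\<Sum>v\<in>V. (x v)\<^sup>2) \<le> h\<^sup>2 / D * ((\<Sum>v\<in>V. (f v)\<^sup>2) + (\<Sum>v\<in>V. (g v)\<^sup>2))"
    using D by (intro mult_left_mono) auto
  also have "\<dots> \<le> (\<Sum>a\<in>V. \<Sum>b\<in>V. A a b * (f a - f b)\<^sup>2) + (\<Sum>a\<in>V. \<Sum>b\<in>V. A a b * (g a - g b)\<^sup>2)"
    using f g by (simp add: ring_distribs)
  also have "\<dots> = (\<Sum>a\<in>V. \<Sum>b\<in>V. A a b * ((f a - f b)\<^sup>2 + (g a - g b)\<^sup>2))"
    by (simp add: sum.distrib ring_distribs)
  also have "\<dots> \<le> (\<Sum>a\<in>V. \<Sum>b\<in>V. A a b * (x a - x b)\<^sup>2)"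
  proof (intro sum_mono mult_left_mono nonneg)
    fix a b
    have xx: "x a - x b = (f a - f b) - (g a - g b)" by (auto simp: f_def g_def)
    have "(f a - f b) * (g a - g b) = - (f a * g b) - f b * g a"
      by (auto simp: f_def g_def max_def algebra_simps)
    moreover have "f a * g b \<ge> 0" "f b * g a \<ge> 0" by (auto simp: f_def g_def)
    ultimately show "(f a - f b)\<^sup>2 + (g a - g b)\<^sup>2 \<le> (x a - x b)\<^sup>2"
      unfolding xx power2_diff[of "f a - f b"] by linarith
  qed
  finally show ?thesis .
qed simp

section \<open>Expansion of the random graph\<close>

lemma finite_vertex_pairs: "finite (vertex_pairs n)"
  unfolding vertex_pairs_def by (rule finite_subset[of _ "Pow {1..n}"]) auto

lemma finite_set_Pi_pmf_bool:
  fixes q :: "'a \<Rightarrow> bool pmf"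
  assumes "finite A"
  shows "finite (set_pmf (Pi_pmf A dflt q))"
  using assms by (rule finite_subset[OF set_Pi_pmf_subset'[OF assms] finite_PiE_dflt]) auto

lemma pmf_chernoff:
  fixes f :: "'a \<Rightarrow> real"
  assumes "finite (set_pmf q)"
  shows "measure_pmf.prob q {x. f x \<ge> a} \<le> exp (- a) * measure_pmf.expectation q (\<lambda>x. exp (f x))"
proof -
  have "measure_pmf.prob q {x \<in> UNIV. f x \<ge> a} \<le>
          exp (- 1 * a) * (\<integral>x\<in>UNIV. exp (1 * f x) \<partial>measure_pmf q)"
    by (rule measure_pmf.Chernoff_ineq_ge)
       (auto simp: set_integrable_def intro!: integrable_measure_pmf_finite assms)
  thus ?thesis by (simp add: set_lebesgue_integral_def)
qed

lemma bernoulli_count_mgf: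
  assumes A: "finite A" and F: "F \<subseteq> A" and p: "0 \<le> p" "p \<le> 1"
  shows "measure_pmf.expectation (Pi_pmf A False (\<lambda>_. bernoulli_pmf p)) (\<lambda>b. exp (s * real (card {e \<in> F. b e})))
          = (1 - p + p * exp s) ^ card F"
proof -
  have finF: "finite F" using A F finite_subset by blast
  have eq: "exp (s * real (card {e \<in> F. b e})) = (\<Prod>e\<in>A. if e \<in> F \<and> b e then exp s else 1)" for b :: "'a \<Rightarrow> bool"
  proof -
    have "(\<Prod>e\<in>A. if e \<in> F \<and> b e then exp s else 1) = (\<Prod>e\<in>A \<inter> {e \<in> F. b e}. exp s)"
      using A by (subst prod.inter_restrict) (auto intro!: prod.cong)
    also have "A \<inter> {e \<in> F. b e} = {e \<in> F. b e}" using F by auto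
    finally show ?thesis by (simp add: exp_of_nat_mult[symmetric] mult.commute)
  qed
  have "measure_pmf.expectation (Pi_pmf A False (\<lambda>_. bernoulli_pmf p)) (\<lambda>b. exp (s * real (card {e \<in> F. b e})))
     = (\<Prod>e\<in>A. measure_pmf.expectation (bernoulli_pmf p) (\<lambda>v. if e \<in> F \<and> v then exp s else 1))"
    unfolding eq by (rule expectation_prod_Pi_pmf[OF A]) (auto intro!: integrable_measure_pmf_finite)
  also have "\<dots> = (\<Prod>e\<in>A. if e \<in> F then 1 - p + p * exp s else 1)"
    using p by (intro prod.cong) (auto simp: algebra_simps)
  also have "\<dots> = (\<Prod>e\<in>A \<inter> F. 1 - p + p * exp s)"
    using A by (simp only: prod.inter_restrict)
  also have "A \<inter> F = F" using F by auto
  finally show ?thesis by simp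
qed

lemma erdos_renyi_mgf:
  assumes F: "F \<subseteq> vertex_pairs n" and p: "0 \<le> p" "p \<le> 1"
  shows "measure_pmf.expectation (erdos_renyi n p) (\<lambda>E. exp (s * real (card (F \<inter> E))))
          = (1 - p + p * exp s) ^ card F"
proof -
  have "F \<inter> {e \<in> vertex_pairs n. b e} = {e \<in> F. b e}" for b using F by auto
  thus ?thesis unfolding erdos_renyi_def
    by (simp add: bernoulli_count_mgf[OF finite_vertex_pairs F p])
qed

lemma erdos_renyi_subset: "E \<in> set_pmf (erdos_renyi n p) \<Longrightarrow> E \<subseteq> vertex_pairs n"
  by (auto simp: erdos_renyi_def)

lemma finite_set_erdos_renyi: "finite (set_pmf (erdos_renyi n p))"
  by (rule finite_subset[of _ "Pow (vertex_pairs n)"])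
     (use erdos_renyi_subset finite_vertex_pairs in auto)

text \<open>
  Chernoff's bound with exponent parameter \<open>1\<close>; the constants only need \<open>exp 1 - 1 \<le> 2\<close>.
\<close>
lemma erdos_renyi_upper_tail:
  assumes F: "F \<subseteq> vertex_pairs n" and p: "0 \<le> p" "p \<le> 1" and M: "real (card F) * p \<le> M"
  shows "measure_pmf.prob (erdos_renyi n p) {E. real (card (F \<inter> E)) \<ge> 3 * M} \<le> exp (- M)"
proof -
  have "measure_pmf.prob (erdos_renyi n p) {E. real (card (F \<inter> E)) \<ge> 3 * M}
      \<le> exp (- (3 * M)) * (1 - p + p * exp 1) ^ card F"
    using pmf_chernoff[OF finite_set_erdos_renyi, of n p "3 * M" "\<lambda>E. real (card (F \<inter> E))"]
      erdos_renyi_mgf[OF F p, of 1] by simp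
  also have "(1 - p + p * exp 1) ^ card F \<le> exp (2 * p) ^ card F"
  proof (intro power_mono)
    have "1 - p + p * exp 1 \<le> 1 - p + p * 3" using p exp_le by (intro add_left_mono mult_left_mono) auto
    also have "\<dots> \<le> exp (2 * p)" using exp_ge_add_one_self[of "2 * p"] by (simp add: algebra_simps)
    finally show "1 - p + p * exp 1 \<le> exp (2 * p)" .
    show "0 \<le> 1 - p + p * exp 1" using p by (intro add_nonneg_nonneg) auto
  qed
  also have "\<dots> = exp (2 * (real (card F) * p))" by (simp add: exp_of_nat_mult[symmetric] algebra_simps)
  also have "\<dots> \<le> exp (2 * M)" using M by simp
  also have "exp (- (3 * M)) * exp (2 * M) = exp (- M)" by (simp add: exp_add[symmetric])
  finally show ?thesis by simp
qed

text \<open>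
  Chernoff's bound with exponent parameter \<open>-1\<close>, using \<open>1 - exp (-1) \<ge> 3/5\<close>.
\<close>
lemma erdos_renyi_lower_tail:
  assumes F: "F \<subseteq> vertex_pairs n" and p: "0 \<le> p" "p \<le> 1"
  shows "measure_pmf.prob (erdos_renyi n p) {E. real (card (F \<inter> E)) \<le> real (card F) * p / 2}
           \<le> exp (- (real (card F) * p / 10))"
proof -
  define M where "M = real (card F) * p"
  have "measure_pmf.prob (erdos_renyi n p) {E. - real (card (F \<inter> E)) \<ge> - (M / 2)}
      \<le> exp (M / 2) * (1 - p + p * exp (-1)) ^ card F"
    using pmf_chernoff[OF finite_set_erdos_renyi, of n p "- (M / 2)" "\<lambda>E. - real (card (F \<inter> E))"]
      erdos_renyi_mgf[OF F p, of "-1"] by simp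
  also have "(1 - p + p * exp (-1)) ^ card F \<le> exp (- (3/5) * p) ^ card F"
  proof (intro power_mono)
    have "exp 1 \<ge> (5/2 :: real)" using exp_lower_Taylor_quadratic[of "1::real"] by simp
    hence "exp (-1) \<le> (2/5 :: real)" by (simp add: exp_minus field_simps)
    hence "1 - p + p * exp (-1) \<le> 1 - p + p * (2/5)" using p by (intro add_left_mono mult_left_mono) auto
    also have "\<dots> \<le> exp (- (3/5) * p)" using exp_ge_add_one_self[of "- (3/5) * p"] by simp
    finally show "1 - p + p * exp (-1) \<le> exp (- (3/5) * p)" .
    show "0 \<le> 1 - p + p * exp (-1)" using p by (intro add_nonneg_nonneg) auto
  qed
  also have "\<dots> = exp (- (3/5) * M)" by (simp add: exp_of_nat_mult[symmetric] algebra_simps M_def)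
  also have "exp (M / 2) * exp (- (3/5) * M) = exp (- (M / 10))" by (simp add: exp_add[symmetric])
  finally show ?thesis by (simp add: M_def)
qed

definition cut_edges :: "nat \<Rightarrow> nat set \<Rightarrow> nat set set" where
  "cut_edges n S = (\<lambda>(a, b). {a, b}) ` (S \<times> ({1..n} - S))"

lemma cut_edges_subset: "S \<subseteq> {1..n} \<Longrightarrow> cut_edges n S \<subseteq> vertex_pairs n"
  by (auto simp: cut_edges_def vertex_pairs_def card_2_iff)

lemma inj_on_cut_edges: "inj_on (\<lambda>(a, b). {a, b}) (S \<times> ({1..n} - S))"
  by (auto simp: inj_on_def doubleton_eq_iff)

lemma card_cut_edges: "S \<subseteq> {1..n} \<Longrightarrow> card (cut_edges n S) = card S * (n - card S)"
  unfolding cut_edges_def card_image[OF inj_on_cut_edges] card_cartesian_product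
  by (subst card_Diff_subset) (auto intro: finite_subset)

lemma card_cut_edges_Int:
  assumes "S \<subseteq> {1..n}"
  shows "real (card (cut_edges n S \<inter> E)) = (\<Sum>a\<in>S. \<Sum>b\<in>{1..n} - S. adj E a b)"
proof -
  have fin: "finite S" using assms finite_subset by blast
  have "cut_edges n S \<inter> E = (\<lambda>(a, b). {a, b}) ` {x \<in> S \<times> ({1..n} - S). (\<lambda>(a, b). {a, b}) x \<in> E}"
    unfolding cut_edges_def by auto
  moreover have "inj_on (\<lambda>(a, b). {a, b}) {x \<in> S \<times> ({1..n} - S). (\<lambda>(a, b). {a, b}) x \<in> E}"
    by (rule inj_on_subset[OF inj_on_cut_edges]) auto
  ultimately have "card (cut_edges n S \<inter> E) = card {x \<in> S \<times> ({1..n} - S). (\<lambda>(a, b). {a, b}) x \<in> E}"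
    by (simp add: card_image)
  also have "real \<dots> = (\<Sum>x\<in>S \<times> ({1..n} - S). of_bool ((\<lambda>(a, b). {a, b}) x \<in> E))"
    using fin by (simp add: sum_of_bool_eq Int_def)
  also have "\<dots> = (\<Sum>(a, b)\<in>S \<times> ({1..n} - S). adj E a b)"
    by (intro sum.cong) (auto simp: adj_def)
  finally show ?thesis by (simp only: sum.cartesian_product)
qed

text \<open>
  The cut of a set of \<open>k \<le> n / 2\<close> vertices has \<open>k (n - k) p \<ge> k n p / 2\<close> edges in
  expectation; the condition asks for half of this lower bound.
\<close>
definition expanding :: "nat \<Rightarrow> real \<Rightarrow> nat set set \<Rightarrow> bool" where
  "expanding n p E \<longleftrightarrow> E \<subseteq> vertex_pairs n
     \<and> (\<forall>S. S \<subseteq> {1..n} \<longrightarrow> S \<noteq> {} \<longrightarrow> 2 * card S \<le> n \<longrightarrow>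
          real n * p / 4 * real (card S) \<le> (\<Sum>a\<in>S. \<Sum>b\<in>{1..n} - S. adj E a b))
     \<and> (\<forall>a\<in>{1..n}. (\<Sum>b = 1..n. adj E a b) \<le> 3 * (real n * p))"

lemma adj_self: "E \<subseteq> vertex_pairs n \<Longrightarrow> adj E a a = 0"
  by (auto simp: adj_def vertex_pairs_def)

text \<open>
  A set of \<open>k\<close> vertices violates the cut condition with probability at most \<open>q ^ k\<close> for some
  \<open>q \<le> n ^ -6\<close>. Summing over all nonempty sets gives at most \<open>(1 + q) ^ n - 1 = O(n ^ -5)\<close>: the
  exponent grows with \<open>k\<close> as fast as the logarithm of the number of sets of size \<open>k\<close> does.
\<close>
lemma erdos_renyi_expanding:
  assumes n: "2 \<le> n" and p: "0 \<le> p" "p \<le> 1" and np: "real n * p \<ge> 120 * ln (real n)"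
  shows "measure_pmf.prob (erdos_renyi n p) {E. \<not> expanding n p E} \<le> 3 / real n ^ 4"
proof -
  let ?P = "measure_pmf.prob (erdos_renyi n p)"
  define q where "q = exp (- (real n * p / 20))"
  define \<S> where "\<S> = {S. S \<subseteq> {1..n} \<and> S \<noteq> {} \<and> 2 * card S \<le> n}"
  have fin\<S>: "finite \<S>" unfolding \<S>_def by (rule finite_subset[of _ "Pow {1..n}"]) auto
  define B1 where "B1 S = {E. real (card (cut_edges n S \<inter> E)) \<le> real (card (cut_edges n S)) * p / 2}" for S
  define B2 where "B2 a = {E. real (card (cut_edges n {a} \<inter> E)) \<ge> 3 * (real n * p)}" for a
  have n0: "real n > 0" using n by simp
  have n6: "real n * (1 / real n ^ 6) = 1 / real n ^ 5"
    using n0 power_Suc[of "real n" 5] by simp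
  have B1: "?P (B1 S) \<le> q ^ card S" if "S \<in> \<S>" for S
  proof -
    have S: "S \<subseteq> {1..n}" "2 * card S \<le> n" using that by (auto simp: \<S>_def)
    have "?P (B1 S) \<le> exp (- (real (card (cut_edges n S)) * p / 10))"
      unfolding B1_def by (rule erdos_renyi_lower_tail[OF cut_edges_subset[OF S(1)] p])
    also have "\<dots> \<le> exp (- (real (card S) * (real n * p / 20)))"
    proof -
      have "real (card S) * (real n / 2) * p \<le> real (card S) * real (n - card S) * p"
        using S p by (intro mult_right_mono mult_left_mono) auto
      thus ?thesis by (simp add: card_cut_edges[OF S(1)] mult_ac)
    qed
    also have "\<dots> = q ^ card S" by (simp add: q_def exp_of_nat_mult[symmetric])
    finally show ?thesis .
  qed
  have B2: "?P (B2 a) \<le> exp (- (real n * p))" if "a \<in> {1..n}" for a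
  proof -
    have a: "{a} \<subseteq> {1..n}" using that by auto
    show ?thesis unfolding B2_def
      by (rule erdos_renyi_upper_tail[OF cut_edges_subset[OF a] p])
         (use p n in \<open>auto simp: card_cut_edges[OF a] intro!: mult_right_mono\<close>)
  qed
  have sub: "set_pmf (erdos_renyi n p) \<inter> {E. \<not> expanding n p E} \<subseteq> (\<Union>S\<in>\<S>. B1 S) \<union> (\<Union>a\<in>{1..n}. B2 a)"
  proof (rule subsetI, rule ccontr)
    fix E assume E: "E \<in> set_pmf (erdos_renyi n p) \<inter> {E. \<not> expanding n p E}"
      and nin: "E \<notin> (\<Union>S\<in>\<S>. B1 S) \<union> (\<Union>a\<in>{1..n}. B2 a)"
    have EV: "E \<subseteq> vertex_pairs n" using E erdos_renyi_subset by blast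
    have "real n * p / 4 * real (card S) \<le> (\<Sum>a\<in>S. \<Sum>b\<in>{1..n} - S. adj E a b)"
      if S: "S \<subseteq> {1..n}" "S \<noteq> {}" "2 * card S \<le> n" for S
    proof -
      have "S \<in> \<S>" using S by (auto simp: \<S>_def)
      hence "E \<notin> B1 S" using nin by blast
      hence "real (card (cut_edges n S)) * p / 2 < (\<Sum>a\<in>S. \<Sum>b\<in>{1..n} - S. adj E a b)"
        by (simp add: B1_def card_cut_edges_Int[OF S(1)])
      moreover have "real (card S) * (real n / 2) * p \<le> real (card S) * real (n - card S) * p"
        using S p by (intro mult_right_mono mult_left_mono) auto
      ultimately show ?thesis by (simp add: card_cut_edges[OF S(1)] mult_ac)
    qed
    moreover have "(\<Sum>b = 1..n. adj E a b) \<le> 3 * (real n * p)" if a: "a \<in> {1..n}" for a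
    proof -
      have a': "{a} \<subseteq> {1..n}" using a by auto
      have "E \<notin> B2 a" using nin a by blast
      hence "(\<Sum>b\<in>{1..n} - {a}. adj E a b) < 3 * (real n * p)"
        by (simp add: B2_def card_cut_edges_Int[OF a'])
      moreover have "(\<Sum>b = 1..n. adj E a b) = adj E a a + (\<Sum>b\<in>{1..n} - {a}. adj E a b)"
        using a by (intro sum.remove) auto
      ultimately show ?thesis by (simp add: adj_self[OF EV])
    qed
    ultimately have "expanding n p E" using EV unfolding expanding_def by blast
    thus False using E by simp
  qed
  have "?P {E. \<not> expanding n p E} = ?P (set_pmf (erdos_renyi n p) \<inter> {E. \<not> expanding n p E})"
    by (subst Int_commute) (simp add: measure_Int_set_pmf)
  also have "\<dots> \<le> ?P ((\<Union>S\<in>\<S>. B1 S) \<union> (\<Union>a\<in>{1..n}. B2 a))"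
    using sub by (intro measure_pmf.finite_measure_mono) auto
  also have "\<dots> \<le> ?P (\<Union>S\<in>\<S>. B1 S) + ?P (\<Union>a\<in>{1..n}. B2 a)"
    by (intro measure_Un_le) auto
  also have "?P (\<Union>S\<in>\<S>. B1 S) \<le> (\<Sum>S\<in>\<S>. ?P (B1 S))"
    by (intro measure_UNION_le fin\<S>) auto
  also have "\<dots> \<le> (\<Sum>S\<in>\<S>. q ^ card S)" by (intro sum_mono B1)
  also have "?P (\<Union>a\<in>{1..n}. B2 a) \<le> (\<Sum>a\<in>{1..n}. ?P (B2 a))"
    by (intro measure_UNION_le) auto
  also have "\<dots> \<le> (\<Sum>a\<in>{1..n}. exp (- (real n * p)))" by (intro sum_mono B2)
  also have "\<dots> = real n * exp (- (real n * p))" by simp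
  also have "\<dots> \<le> real n * (1 / real n ^ 6)"
  proof (intro mult_left_mono)
    have "ln (real n) \<ge> 0" using n by simp
    hence "exp (- (real n * p)) \<le> exp (- (6 * ln (real n)))" using np unfolding exp_le_cancel_iff by linarith
    also have "\<dots> = 1 / real n ^ 6"
      using n0 exp_of_nat_mult[of 6 "ln (real n)"] by (simp add: exp_minus divide_inverse)
    finally show "exp (- (real n * p)) \<le> 1 / real n ^ 6" .
  qed auto
  also have "\<dots> = 1 / real n ^ 5" by (rule n6)
  also have "(\<Sum>S\<in>\<S>. q ^ card S) \<le> 2 / real n ^ 5"
  proof -
    have q: "0 \<le> q" "q \<le> 1 / real n ^ 6"
    proof -
      have "q \<le> exp (- (6 * ln (real n)))" unfolding q_def using np by simp
      also have "\<dots> = 1 / real n ^ 6"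
        using n0 exp_of_nat_mult[of 6 "ln (real n)"] by (simp add: exp_minus divide_inverse)
      finally show "q \<le> 1 / real n ^ 6" .
    qed (simp add: q_def)
    have "1 + (\<Sum>S\<in>\<S>. q ^ card S) = (\<Sum>S\<in>insert {} \<S>. q ^ card S)"
      using fin\<S> by (subst sum.insert) (auto simp: \<S>_def)
    also have "\<dots> \<le> (\<Sum>S\<in>Pow {1..n}. q ^ card S)"
      using q by (intro sum_mono2) (auto simp: \<S>_def)
    also have "\<dots> = (\<Prod>i\<in>{1..n}. q + 1)"
      by (subst prod_add) auto
    also have "\<dots> = (1 + q) ^ n" by (simp add: add.commute)
    also have "\<dots> \<le> exp q ^ n" using q by (intro power_mono) (auto simp: exp_ge_add_one_self)
    also have "\<dots> = exp (real n * q)" by (simp add: exp_of_nat_mult)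
    also have "\<dots> \<le> 1 + real n * q + (real n * q)\<^sup>2"
    proof (intro exp_bound)
      have "real n * q \<le> real n * (1 / real n ^ 6)" using q by (intro mult_left_mono) auto
      also have "\<dots> \<le> 1" unfolding n6 using n by simp
      finally show "real n * q \<le> 1" .
    qed (use q in auto)
    also have "\<dots> \<le> 1 + 2 * (1 / real n ^ 5)"
    proof -
      have "real n * q \<le> real n * (1 / real n ^ 6)" using q by (intro mult_left_mono) auto
      hence nq: "real n * q \<le> 1 / real n ^ 5" by (simp only: n6)
      have "1 / real n ^ 5 \<le> 1" using n by simp
      hence "real n * q \<le> 1" using nq by linarith
      hence "(real n * q)\<^sup>2 \<le> real n * q" using q by (simp add: power2_eq_square mult_left_le)
      thus ?thesis using nq by linarith
    qed
    finally show ?thesis by simp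
  qed
  also have "2 / real n ^ 5 + 1 / real n ^ 5 = 3 / real n ^ 5" by (simp add: add_divide_distrib[symmetric])
  also have "\<dots> \<le> 3 / real n ^ 4"
    using n by (intro divide_left_mono power_increasing mult_pos_pos) auto
  finally show ?thesis by simp
qed

lemma expandingD:
  assumes "expanding n p E"
  shows "E \<subseteq> vertex_pairs n"
    and "\<And>S. S \<subseteq> {1..n} \<Longrightarrow> S \<noteq> {} \<Longrightarrow> 2 * card S \<le> n \<Longrightarrow>
           real n * p / 4 * real (card S) \<le> (\<Sum>a\<in>S. \<Sum>b\<in>{1..n} - S. adj E a b)"
    and "\<And>a. a \<in> {1..n} \<Longrightarrow> (\<Sum>b = 1..n. adj E a b) \<le> 3 * (real n * p)"
  using assms unfolding expanding_def by blast+

text \<open>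
  The cut condition for a single vertex.
\<close>
lemma expanding_degree_lower:
  assumes ex: "expanding n p E" and n: "2 \<le> n" and a: "a \<in> {1..n}"
  shows "real n * p / 4 \<le> (\<Sum>b = 1..n. adj E a b)"
proof -
  have "real n * p / 4 \<le> (\<Sum>b\<in>{1..n} - {a}. adj E a b)"
    using expandingD(2)[OF ex, of "{a}"] a n by simp
  moreover have "(\<Sum>b = 1..n. adj E a b) = adj E a a + (\<Sum>b\<in>{1..n} - {a}. adj E a b)"
    using a by (intro sum.remove) auto
  ultimately show ?thesis by (simp add: adj_self[OF expandingD(1)[OF ex]])
qed

lemma adj_commute: "adj E a b = adj E b a"
  by (simp add: adj_def insert_commute)

lemma expanding_spectral_gap:
  assumes ex: "expanding n p E" and np: "real n * p > 0" and sum0: "(\<Sum>i = 1..n. x i) = 0"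
  shows "real n * p / 48 * (\<Sum>i = 1..n. (x i)\<^sup>2) \<le> (\<Sum>a = 1..n. \<Sum>b = 1..n. adj E a b * (x a - x b)\<^sup>2)"
proof -
  have "(real n * p / 4)\<^sup>2 / (3 * (real n * p)) * (\<Sum>i\<in>{1..n}. (x i)\<^sup>2)
      \<le> (\<Sum>a\<in>{1..n}. \<Sum>b\<in>{1..n}. adj E a b * (x a - x b)\<^sup>2)"
  proof (rule cheeger_inequality)
    show "adj E a b = adj E b a" for a b by (rule adj_commute)
    show "adj E a b \<ge> 0" for a b by (simp add: adj_def)
    show "real n * p / 4 * real (card S) \<le> (\<Sum>a\<in>S. \<Sum>b\<in>{1..n} - S. adj E a b)"
      if "S \<subseteq> {1..n}" "S \<noteq> {}" "2 * card S \<le> card {1..n}" for S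
      by (rule expandingD(2)[OF ex that(1,2)]) (use that(3) in simp)
    show "(\<Sum>b\<in>{1..n}. adj E a b) \<le> 3 * (real n * p)" if "a \<in> {1..n}" for a
      by (rule expandingD(3)[OF ex that])
    show "finite {1..n}" by simp
    show "0 < 3 * (real n * p)" "0 \<le> real n * p / 4" using np by simp_all
    show "(\<Sum>v\<in>{1..n}. x v) = 0" by (rule sum0)
  qed
  also have "(real n * p / 4)\<^sup>2 / (3 * (real n * p)) = real n * p / 48"
    using np by (simp add: power2_eq_square)
  finally show ?thesis .
qed

section \<open>Sub-Gaussian vectors\<close>

text \<open>
  Hoeffding's lemma for a Bernoulli variable. The analytic inequality
  \<open>Hoeffdings_lemma_aux\<close> is for a nonnegative parameter; for the other sign the two outcomes are
  exchanged.
\<close>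
lemma bernoulli_centred_mgf:
  assumes q: "0 \<le> q" "q \<le> 1"
  shows "measure_pmf.expectation (bernoulli_pmf q) (\<lambda>b. exp (t * (q - of_bool b))) \<le> exp (t\<^sup>2 / 8)"
proof -
  have eq: "measure_pmf.expectation (bernoulli_pmf q) (\<lambda>b. exp (t * (q - of_bool b)))
     = q * exp (t * (q - 1)) + (1 - q) * exp (t * q)" using q by simp
  have aux: "exp (- (h * p)) * (1 + p * (exp h - 1)) \<le> exp (h\<^sup>2 / 8)" if "h \<ge> 0" "p \<ge> 0" for h p :: real
  proof -
    have pos: "1 + p * (exp h - 1) > 0" using that by (intro add_pos_nonneg) auto
    have "exp (- (h * p)) * (1 + p * (exp h - 1)) = exp (- h * p + ln (1 + p * (exp h - 1)))"
      by (simp add: exp_diff exp_minus divide_inverse pos)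
    also have "\<dots> \<le> exp (h\<^sup>2 / 8)" using Hoeffdings_lemma_aux[OF that] by simp
    finally show ?thesis .
  qed
  show ?thesis
  proof (cases "t \<ge> 0")
    case True
    have e: "exp (t * (q - 1)) = exp (- (t * (1 - q)))" "exp (t * q) = exp (- (t * (1 - q))) * exp t"
      by (simp_all add: exp_add[symmetric] algebra_simps)
    have "q * exp (t * (q - 1)) + (1 - q) * exp (t * q) = exp (- (t * (1 - q))) * (1 + (1 - q) * (exp t - 1))"
      unfolding e by (simp only: ring_distribs) simp
    thus ?thesis using aux[OF True, of "1 - q"] q unfolding eq by simp
  next
    case False
    have e: "exp (t * (q - 1)) = exp (- ((- t) * q)) * exp (- t)" "exp (t * q) = exp (- ((- t) * q))"
      by (simp_all add: exp_add[symmetric] algebra_simps)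
    have "q * exp (t * (q - 1)) + (1 - q) * exp (t * q) = exp (- ((- t) * q)) * (1 + q * (exp (- t) - 1))"
      unfolding e by (simp only: ring_distribs) simp
    thus ?thesis using aux[of "- t" q] False q unfolding eq by simp
  qed
qed

lemma gaussian_mgf:
  "has_bochner_integral lborel (\<lambda>z. std_normal_density z * exp (a * z)) (exp (a\<^sup>2 / 2))"
proof -
  have "has_bochner_integral lborel (normal_density a 1) 1"
    using integral_normal_density[of 1 a] integrable_normal_density[of 1 a] 
    by (simp add: has_bochner_integral_iff)
  hence "has_bochner_integral lborel (\<lambda>z. exp (a\<^sup>2 / 2) * normal_density a 1 z) (exp (a\<^sup>2 / 2) * 1)"
    by (intro has_bochner_integral_mult_right) auto
  also have "(\<lambda>z. exp (a\<^sup>2 / 2) * normal_density a 1 z) = (\<lambda>z. std_normal_density z * exp (a * z))"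
  proof
    fix z
    have "exp (a\<^sup>2 / 2) * exp (- (z - a)\<^sup>2 / 2) = exp (- z\<^sup>2 / 2) * exp (a * z)"
      unfolding exp_add[symmetric] by (simp add: power2_eq_square algebra_simps add_divide_distrib diff_divide_distrib)
    thus "exp (a\<^sup>2 / 2) * normal_density a 1 z = std_normal_density z * exp (a * z)"
      by (simp add: normal_density_def)
  qed
  finally show ?thesis by simp
qed

lemma gaussian_quarter_square:
  "has_bochner_integral lborel (\<lambda>z. std_normal_density z * exp (z\<^sup>2 / 4)) (sqrt 2)"
proof -
  have "has_bochner_integral lborel (normal_density 0 (sqrt 2)) 1"
    using integral_normal_density[of "sqrt 2" 0] integrable_normal_density[of "sqrt 2" 0] 
    by (simp add: has_bochner_integral_iff)
  hence "has_bochner_integral lborel (\<lambda>z. sqrt 2 * normal_density 0 (sqrt 2) z) (sqrt 2 * 1)"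
    by (intro has_bochner_integral_mult_right) auto
  also have "(\<lambda>z. sqrt 2 * normal_density 0 (sqrt 2) z) = (\<lambda>z. std_normal_density z * exp (z\<^sup>2 / 4))"
  proof
    fix z :: real
    have s: "sqrt 2 * x / (2 * c) = x / (sqrt 2 * c)" for x c :: real
      by (cases "c = 0") (simp_all add: field_simps)
    have "exp (- z\<^sup>2 / 4) = exp (- z\<^sup>2 / 2) * exp (z\<^sup>2 / 4)"
      unfolding exp_add[symmetric] by simp
    thus "sqrt 2 * normal_density 0 (sqrt 2) z = std_normal_density z * exp (z\<^sup>2 / 4)"
      by (simp add: normal_density_def real_sqrt_mult s)
  qed
  finally show ?thesis by simp
qed

text \<open>
  Since \<open>exp (x\<^sup>2 / 2)\<close> is the average of \<open>exp (x z)\<close> over a standard Gaussian \<open>z\<close>, an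
  exponential moment of a sum of squares is a Gaussian average of exponential moments of linear forms.
  The coordinates are converted from linear to quadratic one at a time, so that only one-dimensional
  integrals occur; each conversion costs a factor \<open>sqrt 2\<close>.
\<close>
lemma subgaussian_square_mgf:
  fixes G :: "'i \<Rightarrow> 'a \<Rightarrow> real"
  assumes q: "finite (set_pmf q)" and I: "finite I" and v: "v > 0"
    and sub: "\<And>z. measure_pmf.expectation q (\<lambda>x. exp (\<Sum>i\<in>I. z i * G i x)) \<le> exp (v / 2 * (\<Sum>i\<in>I. (z i)\<^sup>2))"
  shows "measure_pmf.expectation q (\<lambda>x. exp (\<Sum>i\<in>I. (G i x)\<^sup>2 / (4 * v))) \<le> sqrt 2 ^ card I"
proof -
  have E: "measure_pmf.expectation q f = (\<Sum>x\<in>set_pmf q. pmf q x * f x)" for f :: "'a \<Rightarrow> real"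
    using integral_measure_pmf[OF q, of q f] by simp
  have "measure_pmf.expectation q (\<lambda>x. exp ((\<Sum>i\<in>S. (G i x)\<^sup>2 / (4 * v)) + (\<Sum>i\<in>I - S. z i * G i x)))
      \<le> sqrt 2 ^ card S * exp (v / 2 * (\<Sum>i\<in>I - S. (z i)\<^sup>2))" if "S \<subseteq> I" for S z
    using finite_subset[OF that I] that
  proof (induction S arbitrary: z rule: finite_induct)
    case empty
    show ?case using sub[of z] by simp
  next
    case (insert k S)
    define R where "R = I - insert k S"
    have IS: "I - S = insert k R" "k \<notin> R" "finite R" using insert.prems insert.hyps I by (auto simp: R_def)
    \<comment> \<open>With this scaling a Gaussian average over \<open>c t G\<^sub>k\<close> gives exactly \<open>exp (G\<^sub>k\<^sup>2 / (4 v))\<close>, while the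
      moment bound gives \<open>exp (t\<^sup>2 / 4)\<close>, which is still integrable against the Gaussian density.\<close>
    define c where "c = 1 / sqrt (2 * v)"
    have c2: "c\<^sup>2 = 1 / (2 * v)" using v by (simp add: c_def power_divide)
    define H where "H x = exp ((\<Sum>i\<in>S. (G i x)\<^sup>2 / (4 * v)) + (\<Sum>i\<in>R. z i * G i x))" for x
    let ?C = "sqrt 2 ^ card S * exp (v / 2 * (\<Sum>i\<in>R. (z i)\<^sup>2))"
    have step: "measure_pmf.expectation q (\<lambda>x. H x * exp (c * G k x * t)) \<le> ?C * exp (t\<^sup>2 / 4)" for t
    proof -
      have "measure_pmf.expectation q (\<lambda>x. exp ((\<Sum>i\<in>S. (G i x)\<^sup>2 / (4 * v)) + (\<Sum>i\<in>I - S. (z(k := c * t)) i * G i x)))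
         \<le> sqrt 2 ^ card S * exp (v / 2 * (\<Sum>i\<in>I - S. ((z(k := c * t)) i)\<^sup>2))"
        using insert.prems by (intro insert.IH) auto
      also have "(\<Sum>i\<in>I - S. ((z(k := c * t)) i)\<^sup>2) = c\<^sup>2 * t\<^sup>2 + (\<Sum>i\<in>R. (z i)\<^sup>2)"
        unfolding IS(1) using IS(2,3) by (simp add: power_mult_distrib) (intro sum.cong, auto)
      also have "(\<lambda>x. \<Sum>i\<in>I - S. (z(k := c * t)) i * G i x) = (\<lambda>x. c * G k x * t + (\<Sum>i\<in>R. z i * G i x))"
        unfolding IS(1) using IS(2,3) by (auto simp: fun_eq_iff intro!: sum.cong)
      finally have *: "measure_pmf.expectation q (\<lambda>x. exp ((\<Sum>i\<in>S. (G i x)\<^sup>2 / (4 * v)) + (c * G k x * t + (\<Sum>i\<in>R. z i * G i x))))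
         \<le> sqrt 2 ^ card S * exp (v / 2 * (c\<^sup>2 * t\<^sup>2 + (\<Sum>i\<in>R. (z i)\<^sup>2)))"
        by (simp add: fun_eq_iff)
      have "exp ((\<Sum>i\<in>S. (G i x)\<^sup>2 / (4 * v)) + (c * G k x * t + (\<Sum>i\<in>R. z i * G i x))) = H x * exp (c * G k x * t)" for x
        by (simp add: H_def exp_add[symmetric] algebra_simps)
      moreover have "exp (v / 2 * (c\<^sup>2 * t\<^sup>2 + (\<Sum>i\<in>R. (z i)\<^sup>2))) = exp (v / 2 * (\<Sum>i\<in>R. (z i)\<^sup>2)) * exp (t\<^sup>2 / 4)"
        using v by (simp add: exp_add[symmetric] c2 field_simps)
      ultimately show ?thesis using * by simp
    qed
    have hb: "has_bochner_integral lborel (\<lambda>t. \<Sum>x\<in>set_pmf q. pmf q x * H x * (std_normal_density t * exp (c * G k x * t)))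
        (\<Sum>x\<in>set_pmf q. pmf q x * H x * exp ((c * G k x)\<^sup>2 / 2))"
      by (intro has_bochner_integral_sum has_bochner_integral_mult_right gaussian_mgf)
    have "measure_pmf.expectation q (\<lambda>x. exp ((\<Sum>i\<in>insert k S. (G i x)\<^sup>2 / (4 * v)) + (\<Sum>i\<in>R. z i * G i x)))
       = (\<Sum>x\<in>set_pmf q. pmf q x * H x * exp ((c * G k x)\<^sup>2 / 2))"
      unfolding E
    proof (intro sum.cong refl)
      fix x
      have "(c * G k x)\<^sup>2 / 2 = (G k x)\<^sup>2 / (4 * v)" by (simp add: power_mult_distrib c2)
      thus "pmf q x * exp ((\<Sum>i\<in>insert k S. (G i x)\<^sup>2 / (4 * v)) + (\<Sum>i\<in>R. z i * G i x))
         = pmf q x * H x * exp ((c * G k x)\<^sup>2 / 2)"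
        using insert.hyps by (simp add: H_def exp_add)
    qed
    also have "\<dots> = (\<integral>t. (\<Sum>x\<in>set_pmf q. pmf q x * H x * (std_normal_density t * exp (c * G k x * t))) \<partial>lborel)"
      using hb by (simp add: has_bochner_integral_iff)
    also have "\<dots> \<le> (\<integral>t. ?C * (std_normal_density t * exp (t\<^sup>2 / 4)) \<partial>lborel)"
    proof (rule integral_mono)
      show "integrable lborel (\<lambda>t. \<Sum>x\<in>set_pmf q. pmf q x * H x * (std_normal_density t * exp (c * G k x * t)))"
        using hb by (simp add: has_bochner_integral_iff)
      show "integrable lborel (\<lambda>t. ?C * (std_normal_density t * exp (t\<^sup>2 / 4)))"
        using gaussian_quarter_square by (auto simp: has_bochner_integral_iff)
      fix t :: real
      have "(\<Sum>x\<in>set_pmf q. pmf q x * H x * (std_normal_density t * exp (c * G k x * t)))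
          = std_normal_density t * measure_pmf.expectation q (\<lambda>x. H x * exp (c * G k x * t))"
        unfolding E by (simp add: sum_distrib_left algebra_simps)
      also have "\<dots> \<le> std_normal_density t * (?C * exp (t\<^sup>2 / 4))"
        by (intro mult_left_mono step) auto
      finally show "(\<Sum>x\<in>set_pmf q. pmf q x * H x * (std_normal_density t * exp (c * G k x * t)))
         \<le> ?C * (std_normal_density t * exp (t\<^sup>2 / 4))" by (simp add: algebra_simps)
    qed
    also have "\<dots> = ?C * sqrt 2"
      using gaussian_quarter_square by (simp add: has_bochner_integral_iff)
    finally show ?case using insert.hyps by (simp add: R_def algebra_simps)
  qed
  from this[of I] show ?thesis by simp
qed

text \<open>
  A Chernoff bound at level \<open>2 card I\<close> beats the moment \<open>(sqrt 2) ^ card I\<close> of the previous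
  lemma by an exponential factor. The threshold is a constant times the variance proxy
  \<open>v \<cdot> card I\<close>: a union bound over coordinates would lose a logarithm here.
\<close>
lemma subgaussian_norm_tail:
  fixes G :: "'i \<Rightarrow> 'a \<Rightarrow> real"
  assumes q: "finite (set_pmf q)" and I: "finite I" and v: "v > 0"
    and sub: "\<And>z. measure_pmf.expectation q (\<lambda>x. exp (\<Sum>i\<in>I. z i * G i x)) \<le> exp (v / 2 * (\<Sum>i\<in>I. (z i)\<^sup>2))"
  shows "measure_pmf.prob q {x. (\<Sum>i\<in>I. (G i x)\<^sup>2) > 8 * v * real (card I)} \<le> exp (- real (card I))"
proof -
  have "measure_pmf.prob q {x. (\<Sum>i\<in>I. (G i x)\<^sup>2) > 8 * v * real (card I)}
     \<le> measure_pmf.prob q {x. (\<Sum>i\<in>I. (G i x)\<^sup>2 / (4 * v)) \<ge> 2 * real (card I)}"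
    using v by (intro measure_pmf.finite_measure_mono)
      (auto simp: sum_divide_distrib[symmetric] field_simps)
  also have "\<dots> \<le> exp (- (2 * real (card I))) * measure_pmf.expectation q (\<lambda>x. exp (\<Sum>i\<in>I. (G i x)\<^sup>2 / (4 * v)))"
    by (rule pmf_chernoff[OF q])
  also have "\<dots> \<le> exp (- (2 * real (card I))) * exp 1 ^ card I"
  proof (intro mult_left_mono)
    have "sqrt 2 \<le> (2 :: real)" by (rule real_le_lsqrt) auto
    also have "2 \<le> exp (1 :: real)" using exp_ge_add_one_self[of "1::real"] by simp
    finally have "sqrt 2 ^ card I \<le> exp (1::real) ^ card I" by (intro power_mono) auto
    thus "measure_pmf.expectation q (\<lambda>x. exp (\<Sum>i\<in>I. (G i x)\<^sup>2 / (4 * v))) \<le> exp 1 ^ card I"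
      using subgaussian_square_mgf[OF q I v sub] by linarith
  qed auto
  also have "\<dots> = exp (- real (card I))"
    by (simp add: exp_of_nat_mult[symmetric] exp_add[symmetric])
  finally show ?thesis .
qed

lemma subgaussian_coordinate_tail:
  fixes G :: "'i \<Rightarrow> 'a \<Rightarrow> real"
  assumes q: "finite (set_pmf q)" and I: "finite I" "k \<in> I" and v: "v > 0" and t: "t \<ge> 0"
    and sub: "\<And>z. measure_pmf.expectation q (\<lambda>x. exp (\<Sum>i\<in>I. z i * G i x)) \<le> exp (v / 2 * (\<Sum>i\<in>I. (z i)\<^sup>2))"
  shows "measure_pmf.prob q {x. \<bar>G k x\<bar> > t} \<le> 2 * exp (- (t\<^sup>2 / (2 * v)))"
proof -
  have one: "measure_pmf.prob q {x. s * G k x \<ge> t} \<le> exp (- (t\<^sup>2 / (2 * v)))" if s: "s\<^sup>2 = 1" for s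
  proof -
    have "measure_pmf.prob q {x. s * G k x \<ge> t} \<le> measure_pmf.prob q {x. t / v * s * G k x \<ge> t\<^sup>2 / v}"
    proof (intro measure_pmf.finite_measure_mono)
      show "{x. s * G k x \<ge> t} \<subseteq> {x. t / v * s * G k x \<ge> t\<^sup>2 / v}"
      proof clarify
        fix x assume "s * G k x \<ge> t"
        hence "t / v * (s * G k x) \<ge> t / v * t" using t v by (intro mult_left_mono) auto
        thus "t / v * s * G k x \<ge> t\<^sup>2 / v" by (simp add: power2_eq_square)
      qed
    qed auto
    also have "\<dots> \<le> exp (- (t\<^sup>2 / v)) * measure_pmf.expectation q (\<lambda>x. exp (t / v * s * G k x))"
      by (rule pmf_chernoff[OF q])
    also have "measure_pmf.expectation q (\<lambda>x. exp (t / v * s * G k x)) \<le> exp (v / 2 * (t / v * s)\<^sup>2)"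
      using sub[of "\<lambda>i. if i = k then t / v * s else 0"] I
      by (simp add: if_distrib[of "\<lambda>x. x * _"] if_distrib[of "\<lambda>x. x\<^sup>2"] sum.delta' cong: if_cong)
    also have "v / 2 * (t / v * s)\<^sup>2 = t\<^sup>2 / (2 * v)"
      using v s by (simp add: power_mult_distrib power_divide) (simp add: power2_eq_square)
    also have "exp (- (t\<^sup>2 / v)) * exp (t\<^sup>2 / (2 * v)) = exp (- (t\<^sup>2 / (2 * v)))"
      using v by (simp add: exp_add[symmetric] field_simps)
    finally show ?thesis by simp
  qed
  have "measure_pmf.prob q {x. \<bar>G k x\<bar> > t}
    \<le> measure_pmf.prob q ({x. 1 * G k x \<ge> t} \<union> {x. (-1) * G k x \<ge> t})"
    by (intro measure_pmf.finite_measure_mono) auto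
  also have "\<dots> \<le> measure_pmf.prob q {x. 1 * G k x \<ge> t} + measure_pmf.prob q {x. (-1) * G k x \<ge> t}"
    by (intro measure_Un_le) auto
  also have "\<dots> \<le> 2 * exp (- (t\<^sup>2 / (2 * v)))" using one[of 1] one[of "-1"] by simp
  finally show ?thesis .
qed

section \<open>The score at the true parameter\<close>

definition pairs :: "nat \<Rightarrow> (nat \<times> nat) set" where
  "pairs n = {(i, j). 1 \<le> i \<and> i < j \<and> j \<le> n}"

lemma finite_pairs: "finite (pairs n)"
  by (rule finite_subset[of _ "{1..n} \<times> {1..n}"]) (auto simp: pairs_def)

lemma sum_square_eq_sum_pairs:
  fixes f :: "nat \<Rightarrow> nat \<Rightarrow> real"
  shows "(\<Sum>a = 1..n. \<Sum>b = 1..n. f a b) = (\<Sum>(a, b)\<in>pairs n. f a b + f b a) + (\<Sum>a = 1..n. f a a)"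
proof -
  let ?g = "\<lambda>(a, b). f a b" and ?D = "(\<lambda>a. (a, a)) ` {1..n}"
  have U: "{1..n} \<times> {1..n} = pairs n \<union> (prod.swap ` pairs n \<union> ?D)"
  proof (intro equalityI subsetI)
    fix x assume x: "x \<in> {1..n} \<times> {1..n}"
    obtain a b where ab: "x = (a, b)" by force
    consider "a < b" | "b < a" | "a = b" by linarith
    thus "x \<in> pairs n \<union> (prod.swap ` pairs n \<union> ?D)"
    proof cases
      case 2
      hence "x = prod.swap (b, a)" "(b, a) \<in> pairs n" using x ab by (auto simp: pairs_def)
      thus ?thesis by blast
    qed (use x ab in \<open>auto simp: pairs_def\<close>)
  qed (auto simp: pairs_def)
  have "(\<Sum>a = 1..n. \<Sum>b = 1..n. f a b) = sum ?g ({1..n} \<times> {1..n})"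
    by (simp only: sum.cartesian_product)
  also have "\<dots> = sum ?g (pairs n) + (sum ?g (prod.swap ` pairs n) + sum ?g ?D)"
    unfolding U using finite_pairs
    by (subst sum.union_disjoint; (subst sum.union_disjoint)?) (auto simp: pairs_def)
  also have "sum ?g (prod.swap ` pairs n) = (\<Sum>(a, b)\<in>pairs n. f b a)"
    by (subst sum.reindex) (auto simp: inj_on_def intro!: sum.cong)
  also have "sum ?g ?D = (\<Sum>a = 1..n. f a a)"
    by (subst sum.reindex) (auto simp: inj_on_def)
  finally show ?thesis by (simp add: sum.distrib case_prod_unfold)
qed

text \<open>
  Summation by parts on the graph: an antisymmetric flow paired with the gradient of \<open>u\<close> equals its
  divergence paired with \<open>u\<close>.
\<close>
lemma sum_pairs_antisym:
  fixes \<phi> :: "nat \<Rightarrow> nat \<Rightarrow> real"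
  assumes "\<And>a b. \<phi> b a = - \<phi> a b"
  shows "(\<Sum>(a, b)\<in>pairs n. \<phi> a b * (u a - u b)) = (\<Sum>a = 1..n. u a * (\<Sum>b = 1..n. \<phi> a b))"
proof -
  have "\<phi> a a = 0" for a using assms[of a a] by simp
  hence "(\<Sum>a = 1..n. u a * (\<Sum>b = 1..n. \<phi> a b)) = (\<Sum>(a, b)\<in>pairs n. u a * \<phi> a b + u b * \<phi> b a)"
    unfolding sum_distrib_left by (subst sum_square_eq_sum_pairs) simp
  also have "\<dots> = (\<Sum>(a, b)\<in>pairs n. \<phi> a b * (u a - u b))"
  proof (intro sum.cong refl, clarify)
    fix a b
    show "u a * \<phi> a b + u b * \<phi> b a = \<phi> a b * (u a - u b)"
      using assms[of b a] by (simp add: algebra_simps)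
  qed
  finally show ?thesis by simp
qed

lemma sum_comparisons:
  fixes f :: "nat \<Rightarrow> nat \<Rightarrow> nat \<Rightarrow> real"
  shows "(\<Sum>(a, b, l)\<in>comparisons n L E. f a b l) = (\<Sum>(a, b)\<in>pairs n. adj E a b * (\<Sum>l = 1..L. f a b l))"
proof -
  let ?P = "{x \<in> pairs n. {fst x, snd x} \<in> E}"
  have fin: "finite ?P" using finite_pairs by auto
  have "(\<Sum>(a, b)\<in>pairs n. adj E a b * (\<Sum>l = 1..L. f a b l))
      = (\<Sum>x\<in>pairs n. if {fst x, snd x} \<in> E then (\<Sum>l = 1..L. f (fst x) (snd x) l) else 0)"
    by (intro sum.cong) (auto simp: adj_def)
  also have "\<dots> = (\<Sum>x\<in>?P. \<Sum>l = 1..L. f (fst x) (snd x) l)"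
    using finite_pairs by (simp only: sum.inter_filter)
  also have "\<dots> = (\<Sum>(x, l)\<in>?P \<times> {1..L}. f (fst x) (snd x) l)"
    by (simp only: sum.cartesian_product)
  also have "\<dots> = (\<Sum>(a, b, l)\<in>comparisons n L E. f a b l)"
    by (rule sum.reindex_bij_witness[of _ "\<lambda>(a, b, l). ((a, b), l)" "\<lambda>((a, b), l). (a, b, l)"])
       (auto simp: comparisons_def pairs_def)
  finally show ?thesis by simp
qed

lemma finite_comparisons: "finite (comparisons n L E)"
  by (rule finite_subset[of _ "{1..n} \<times> {1..n} \<times> {1..L}"]) (auto simp: comparisons_def)

text \<open>
  Outcomes are only recorded for \<open>a < b\<close>. This is the antisymmetric extension of
  \<open>\<psi>(\<theta>\<^sub>a - \<theta>\<^sub>b) - Y\<^sub>a\<^sub>b\<close> to all pairs, which allows sums over neighbours in any order.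
\<close>
definition residual :: "(nat \<Rightarrow> nat \<Rightarrow> real) \<Rightarrow> (nat \<Rightarrow> real) \<Rightarrow> nat \<Rightarrow> nat \<Rightarrow> real" where
  "residual Y \<theta> a b =
     (if a < b then psi (\<theta> a - \<theta> b) - Y a b
      else if b < a then Y b a - psi (\<theta> b - \<theta> a) else 0)"

text \<open>
  The \<open>i\<close>-th partial derivative of the negative log-likelihood with data \<open>Y\<close>.
\<close>
definition score :: "nat \<Rightarrow> nat set set \<Rightarrow> (nat \<Rightarrow> nat \<Rightarrow> real) \<Rightarrow> (nat \<Rightarrow> real) \<Rightarrow> nat \<Rightarrow> real" where
  "score n E Y \<theta> i = (\<Sum>b = 1..n. adj E i b * residual Y \<theta> i b)"

lemma score_inner:
  "(\<Sum>i = 1..n. u i * score n E Y \<theta> i) =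
     (\<Sum>(a, b)\<in>pairs n. adj E a b * (psi (\<theta> a - \<theta> b) - Y a b) * (u a - u b))"
proof -
  have "(\<Sum>i = 1..n. u i * score n E Y \<theta> i) =
     (\<Sum>(a, b)\<in>pairs n. adj E a b * residual Y \<theta> a b * (u a - u b))"
    unfolding score_def
  proof (rule sum_pairs_antisym[symmetric])
    show "adj E b a * residual Y \<theta> b a = - (adj E a b * residual Y \<theta> a b)" for a b
      using adj_commute[of E a b] by (auto simp: residual_def algebra_simps)
  qed
  also have "\<dots> = (\<Sum>(a, b)\<in>pairs n. adj E a b * (psi (\<theta> a - \<theta> b) - Y a b) * (u a - u b))"
    by (intro sum.cong) (auto simp: residual_def pairs_def)
  finally show ?thesis .
qed

lemma sum_pairs_diff_square_le:
  assumes deg: "\<And>a. a \<in> {1..n} \<Longrightarrow> (\<Sum>b = 1..n. adj E a b) \<le> D"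
  shows "(\<Sum>(a, b)\<in>pairs n. adj E a b * (u a - u b)\<^sup>2) \<le> 2 * D * (\<Sum>i = 1..n. (u i)\<^sup>2)"
proof -
  have "(\<Sum>(a, b)\<in>pairs n. adj E a b * (u a - u b)\<^sup>2)
      \<le> (\<Sum>(a, b)\<in>pairs n. adj E a b * (2 * (u a)\<^sup>2) + adj E b a * (2 * (u b)\<^sup>2))"
  proof (intro sum_mono, clarify)
    fix a b
    have "(u a - u b)\<^sup>2 \<le> 2 * (u a)\<^sup>2 + 2 * (u b)\<^sup>2"
      using zero_le_power2[of "u a + u b"] by (simp add: power2_eq_square algebra_simps)
    thus "adj E a b * (u a - u b)\<^sup>2 \<le> adj E a b * (2 * (u a)\<^sup>2) + adj E b a * (2 * (u b)\<^sup>2)"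
      by (simp add: adj_commute[of E b a]) (simp add: adj_def)
  qed
  also have "\<dots> \<le> \<dots> + (\<Sum>a = 1..n. adj E a a * (2 * (u a)\<^sup>2))"
    by (simp add: sum_nonneg adj_def)
  also have "\<dots> = (\<Sum>a = 1..n. \<Sum>b = 1..n. adj E a b * (2 * (u a)\<^sup>2))"
    by (rule sum_square_eq_sum_pairs[symmetric])
  also have "\<dots> = (\<Sum>a = 1..n. (\<Sum>b = 1..n. adj E a b) * (2 * (u a)\<^sup>2))"
    by (simp add: sum_distrib_right)
  also have "\<dots> \<le> (\<Sum>a = 1..n. D * (2 * (u a)\<^sup>2))"
    by (intro sum_mono mult_right_mono deg) auto
  finally show ?thesis by (simp add: sum_distrib_left algebra_simps)
qed

lemma psi_bounds: "0 < psi t" "psi t < 1"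
  by (auto simp: psi_def field_simps add_pos_pos)

lemma finite_set_btl_outcomes: "finite (set_pmf (btl_outcomes n L \<theta> E))"
  unfolding btl_outcomes_def by (intro finite_set_Pi_pmf_bool finite_comparisons)

text \<open>
  The linear form \<open>\<langle>u, g\<rangle>\<close> is a sum of independent terms \<open>(u\<^sub>a - u\<^sub>b) / L\<close> times a centred
  Bernoulli variable, one for each comparison.
\<close>
lemma score_mgf:
  assumes L: "1 \<le> L" and deg: "\<And>a. a \<in> {1..n} \<Longrightarrow> (\<Sum>b = 1..n. adj E a b) \<le> D"
  shows "measure_pmf.expectation (btl_outcomes n L \<theta> E) (\<lambda>y. exp (\<Sum>i = 1..n. u i * score n E (ybar L y) \<theta> i))
           \<le> exp (D / (2 * real L) / 2 * (\<Sum>i = 1..n. (u i)\<^sup>2))"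
proof -
  let ?C = "comparisons n L E"
  define t where "t c = (case c of (a, b, l::nat) \<Rightarrow> (u a - u b) / real L)" for c
  define r where "r c = (case c of (a, b, l::nat) \<Rightarrow> psi (\<theta> a - \<theta> b))" for c
  have inner: "(\<Sum>i = 1..n. u i * score n E (ybar L y) \<theta> i) = (\<Sum>c\<in>?C. t c * (r c - of_bool (y c)))" for y
  proof -
    have "(\<Sum>c\<in>?C. t c * (r c - of_bool (y c)))
       = (\<Sum>(a, b, l)\<in>?C. (u a - u b) / real L * (psi (\<theta> a - \<theta> b) - of_bool (y (a, b, l))))"
      by (intro sum.cong) (auto simp: t_def r_def)
    also have "\<dots> = (\<Sum>(a, b)\<in>pairs n. adj E a b * (\<Sum>l = 1..L. (u a - u b) / real L * (psi (\<theta> a - \<theta> b) - of_bool (y (a, b, l)))))"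
      by (rule sum_comparisons)
    also have "\<dots> = (\<Sum>(a, b)\<in>pairs n. adj E a b * (psi (\<theta> a - \<theta> b) - ybar L y a b) * (u a - u b))"
    proof (intro sum.cong refl, clarify)
      fix a b
      have "(\<Sum>l = 1..L. (u a - u b) / real L * (psi (\<theta> a - \<theta> b) - of_bool (y (a, b, l))))
         = (u a - u b) / real L * (\<Sum>l = 1..L. psi (\<theta> a - \<theta> b) - of_bool (y (a, b, l)))"
        by (rule sum_distrib_left[symmetric])
      also have "(\<Sum>l = 1..L. psi (\<theta> a - \<theta> b) - of_bool (y (a, b, l)))
         = real L * psi (\<theta> a - \<theta> b) - (\<Sum>l = 1..L. of_bool (y (a, b, l)))"
        by (simp only: sum_subtractf) simp
      also have "(u a - u b) / real L * \<dots> = (psi (\<theta> a - \<theta> b) - ybar L y a b) * (u a - u b)"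
        using L by (simp add: ybar_def field_simps)
      finally show "adj E a b * (\<Sum>l = 1..L. (u a - u b) / real L * (psi (\<theta> a - \<theta> b) - of_bool (y (a, b, l))))
         = adj E a b * (psi (\<theta> a - \<theta> b) - ybar L y a b) * (u a - u b)" by (simp only: mult.assoc)
    qed
    finally show ?thesis unfolding score_inner by simp
  qed
  have r: "0 \<le> r c" "r c \<le> 1" for c
    using psi_bounds by (auto simp: r_def less_imp_le split: prod.splits)
  have rc: "(\<lambda>(i, j, l). bernoulli_pmf (psi (\<theta> i - \<theta> j))) = (\<lambda>c. bernoulli_pmf (r c))"
    by (auto simp: r_def fun_eq_iff)
  have "measure_pmf.expectation (btl_outcomes n L \<theta> E) (\<lambda>y. exp (\<Sum>i = 1..n. u i * score n E (ybar L y) \<theta> i))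
     = measure_pmf.expectation (Pi_pmf ?C False (\<lambda>c. bernoulli_pmf (r c)))
         (\<lambda>y. \<Prod>c\<in>?C. exp (t c * (r c - of_bool (y c))))"
    unfolding inner btl_outcomes_def rc by (simp add: exp_sum finite_comparisons)
  also have "\<dots> = (\<Prod>c\<in>?C. measure_pmf.expectation (bernoulli_pmf (r c)) (\<lambda>b. exp (t c * (r c - of_bool b))))"
    by (rule expectation_prod_Pi_pmf) (auto intro: finite_comparisons integrable_measure_pmf_finite)
  also have "\<dots> \<le> (\<Prod>c\<in>?C. exp ((t c)\<^sup>2 / 8))"
    by (intro prod_mono conjI bernoulli_centred_mgf r) (auto intro!: Bochner_Integration.integral_nonneg)
  also have "\<dots> = exp (\<Sum>c\<in>?C. (t c)\<^sup>2 / 8)" by (simp add: exp_sum finite_comparisons)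
  also have "(\<Sum>c\<in>?C. (t c)\<^sup>2 / 8) = (\<Sum>(a, b, l)\<in>?C. ((u a - u b) / real L)\<^sup>2 / 8)"
    by (intro sum.cong) (auto simp: t_def)
  also have "\<dots> = (\<Sum>(a, b)\<in>pairs n. adj E a b * (\<Sum>l = 1..L. ((u a - u b) / real L)\<^sup>2 / 8))"
    by (rule sum_comparisons)
  also have "\<dots> = 1 / (8 * real L) * (\<Sum>(a, b)\<in>pairs n. adj E a b * (u a - u b)\<^sup>2)"
    using L unfolding sum_distrib_left
    by (intro sum.cong) (auto simp: power_divide power2_eq_square field_simps)
  also have "\<dots> \<le> 1 / (8 * real L) * (2 * D * (\<Sum>i = 1..n. (u i)\<^sup>2))"
    by (intro mult_left_mono sum_pairs_diff_square_le deg) auto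
  finally show ?thesis by (simp add: field_simps)
qed

lemma exp_minus_le_inverse_power4:
  assumes "n > 0"
  shows "exp (- real n) \<le> 256 / real n ^ 4"
proof -
  have "real n / 4 \<le> exp (real n / 4)" using exp_ge_add_one_self[of "real n / 4"] by linarith
  hence "(real n / 4) ^ 4 \<le> exp (real n / 4) ^ 4" by (intro power_mono) auto
  also have "\<dots> = exp (real n)" by (simp add: exp_of_nat_mult[symmetric])
  finally have "real n ^ 4 / 256 \<le> exp (real n)" by (simp add: power_divide)
  thus ?thesis using assms by (simp add: exp_minus field_simps)
qed

text \<open>
  The variance proxy is \<open>v = D / (2 L)\<close>. The coordinates are bounded at level
  \<open>sqrt (10 v log n)\<close>, so that the failure probability \<open>2 n ^ -5\<close> survives a union bound over
  \<open>n\<close> coordinates.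
\<close>
lemma score_tail:
  assumes n: "2 \<le> n" and L: "1 \<le> L" and D: "D > 0"
    and deg: "\<And>a. a \<in> {1..n} \<Longrightarrow> (\<Sum>b = 1..n. adj E a b) \<le> D"
  shows "measure_pmf.prob (btl_outcomes n L \<theta> E)
     {y. \<not> ((\<forall>i\<in>{1..n}. \<bar>score n E (ybar L y) \<theta> i\<bar> \<le> sqrt (5 * D * ln (real n) / real L))
          \<and> (\<Sum>i = 1..n. (score n E (ybar L y) \<theta> i)\<^sup>2) \<le> 4 * real n * D / real L)} \<le> 258 / real n ^ 4"
    (is "measure_pmf.prob _ ?B \<le> _")
proof -
  let ?P = "measure_pmf.prob (btl_outcomes n L \<theta> E)"
  define v where "v = D / (2 * real L)"
  have v: "v > 0" using D L by (simp add: v_def)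
  define t where "t = sqrt (5 * D * ln (real n) / real L)"
  have ln0: "ln (real n) \<ge> 0" using n by simp
  have t0: "t \<ge> 0" and t2: "t\<^sup>2 = 5 * D * ln (real n) / real L" using D ln0 by (auto simp: t_def)
  note fin = finite_set_btl_outcomes[of n L \<theta> E]
  have sub: "measure_pmf.expectation (btl_outcomes n L \<theta> E) (\<lambda>y. exp (\<Sum>i\<in>{1..n}. z i * score n E (ybar L y) \<theta> i))
      \<le> exp (v / 2 * (\<Sum>i\<in>{1..n}. (z i)\<^sup>2))" for z
    unfolding v_def by (rule score_mgf[OF L deg])
  have sub': "measure_pmf.expectation (btl_outcomes n L \<theta> E) (\<lambda>y. exp (\<Sum>i\<in>{1..n}. z i * (\<lambda>i y. score n E (ybar L y) \<theta> i) i y))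
      \<le> exp (v / 2 * (\<Sum>i\<in>{1..n}. (z i)\<^sup>2))" for z using sub by simp
  have coord: "?P {y. \<bar>score n E (ybar L y) \<theta> i\<bar> > t} \<le> 2 * (1 / real n ^ 5)" if "i \<in> {1..n}" for i
  proof -
    have "?P {y. \<bar>score n E (ybar L y) \<theta> i\<bar> > t} \<le> 2 * exp (- (t\<^sup>2 / (2 * v)))"
      by (rule subgaussian_coordinate_tail[OF fin _ that v t0 sub']) auto
    also have "t\<^sup>2 / (2 * v) = 5 * ln (real n)" unfolding t2 v_def using D L by simp
    also have "exp (- (5 * ln (real n))) = 1 / real n ^ 5"
      using n exp_of_nat_mult[of 5 "ln (real n)"] by (simp add: exp_minus divide_inverse)
    finally show ?thesis .
  qed
  have norm: "?P {y. (\<Sum>i\<in>{1..n}. (score n E (ybar L y) \<theta> i)\<^sup>2) > 8 * v * real (card {1..n})} \<le> exp (- real (card {1..n}))"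
    by (rule subgaussian_norm_tail[OF fin _ v sub']) auto
  have v8: "8 * v * real (card {1..n}) = 4 * real n * D / real L" by (simp add: v_def)
  have "?P ?B \<le> ?P ((\<Union>i\<in>{1..n}. {y. \<bar>score n E (ybar L y) \<theta> i\<bar> > t})
       \<union> {y. (\<Sum>i\<in>{1..n}. (score n E (ybar L y) \<theta> i)\<^sup>2) > 8 * v * real (card {1..n})})"
    unfolding v8 by (intro measure_pmf.finite_measure_mono) (auto simp: t_def not_le)
  also have "\<dots> \<le> ?P (\<Union>i\<in>{1..n}. {y. \<bar>score n E (ybar L y) \<theta> i\<bar> > t})
       + ?P {y. (\<Sum>i\<in>{1..n}. (score n E (ybar L y) \<theta> i)\<^sup>2) > 8 * v * real (card {1..n})}"
    by (intro measure_Un_le) auto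
  also have "?P (\<Union>i\<in>{1..n}. {y. \<bar>score n E (ybar L y) \<theta> i\<bar> > t}) \<le> (\<Sum>i\<in>{1..n}. ?P {y. \<bar>score n E (ybar L y) \<theta> i\<bar> > t})"
    by (intro measure_UNION_le) auto
  also have "\<dots> \<le> (\<Sum>i\<in>{1..n}. 2 * (1 / real n ^ 5))" by (intro sum_mono coord)
  also have "\<dots> = 2 / real n ^ 4" using n power_Suc[of "real n" 4] by simp
  also note norm
  also have "exp (- real (card {1..n})) \<le> 256 / real n ^ 4" using exp_minus_le_inverse_power4[of n] n by simp
  also have "2 / real n ^ 4 + 256 / real n ^ 4 = 258 / real n ^ 4" by (simp add: add_divide_distrib[symmetric])
  finally show ?thesis by simp
qed

section \<open>The regularised likelihood and its score equation\<close>

lemma psi_uminus: "psi (- t) = 1 - psi t"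
proof -
  have "1 + exp t > 0" "1 + exp (- t) > (0::real)" by (auto intro: add_pos_pos)
  thus ?thesis by (simp add: psi_def field_simps exp_minus)
qed

lemma DERIV_psi: "(psi has_real_derivative psi t * (1 - psi t)) (at t)"
proof -
  have pos: "1 + exp (- t) > 0" by (auto intro: add_pos_pos)
  have "((\<lambda>t. 1 / (1 + exp (- t))) has_real_derivative exp (- t) / (1 + exp (- t))\<^sup>2) (at t)"
    using pos by (auto intro!: derivative_eq_intros simp: power2_eq_square)
  also have "(\<lambda>t. 1 / (1 + exp (- t))) = psi" by (simp add: psi_def fun_eq_iff)
  also have "exp (- t) / (1 + exp (- t))\<^sup>2 = psi t * (1 - psi t)"
    using pos by (simp add: psi_def field_simps power2_eq_square)
  finally show ?thesis .
qed

lemma psi_variance_le: "psi t * (1 - psi t) \<le> 1 / 4"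
  using zero_le_power2[of "psi t - 1 / 2"] by (simp add: power2_eq_square algebra_simps)

lemma psi_variance_ge: "exp (- \<bar>t\<bar>) / 4 \<le> psi t * (1 - psi t)"
proof -
  have nonneg: "exp (- t) / 4 \<le> psi t * (1 - psi t)" if "t \<ge> 0" for t
  proof -
    have "1 / 2 \<le> psi t" using that by (simp add: psi_def field_simps add_pos_pos)
    moreover have "exp (- t) / 2 \<le> 1 - psi t"
    proof -
      have e: "1 - psi t = exp (- t) / (1 + exp (- t))"
        by (simp add: psi_def field_simps add_pos_pos add_nonneg_eq_0_iff)
      show ?thesis unfolding e using that by (intro divide_left_mono mult_pos_pos add_pos_pos) auto
    qed
    ultimately have "1 / 2 * (exp (- t) / 2) \<le> psi t * (1 - psi t)" by (intro mult_mono) auto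
    thus ?thesis by simp
  qed
  show ?thesis
  proof (cases "t \<ge> 0")
    case True thus ?thesis using nonneg[of t] by simp
  next
    case False
    thus ?thesis using nonneg[of "- t"] psi_uminus[of t] by (simp add: algebra_simps)
  qed
qed

text \<open>
  The mean value theorem for \<open>\<psi>\<close>, whose derivative \<open>\<psi> (1 - \<psi>)\<close> lies between
  \<open>exp (- \<bar>t\<bar>) / 4\<close> and \<open>1 / 4\<close>.
\<close>
lemma psi_slope:
  assumes d: "\<bar>d\<bar> \<le> k" and \<delta>: "\<bar>\<delta>\<bar> \<le> r"
  obtains w where "psi (d + \<delta>) - psi d = w * \<delta>" "exp (- (k + r)) / 4 \<le> w" "w \<le> 1 / 4"
proof -
  have slope: "exp (- (k + r)) / 4 \<le> psi z * (1 - psi z)" if "\<bar>z\<bar> \<le> k + r" for z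
  proof -
    have "exp (- (k + r)) / 4 \<le> exp (- \<bar>z\<bar>) / 4" using that by simp
    thus ?thesis using psi_variance_ge[of z] by linarith
  qed
  consider "\<delta> = 0" | "\<delta> > 0" | "\<delta> < 0" by linarith
  thus ?thesis
  proof cases
    case 1
    have "\<bar>d\<bar> \<le> k + r" using d \<delta> 1 by linarith
    from slope[OF this] show ?thesis using 1 psi_variance_le[of d] by (intro that) auto
  next
    case 2
    obtain z where z: "d < z" "z < d + \<delta>" "psi (d + \<delta>) - psi d = (d + \<delta> - d) * (psi z * (1 - psi z))"
      using MVT2[of d "d + \<delta>" psi "\<lambda>z. psi z * (1 - psi z)"] 2 DERIV_psi by auto
    have "\<bar>z\<bar> \<le> k + r" using d \<delta> z by linarith
    from slope[OF this] show ?thesis using z psi_variance_le[of z] by (intro that) auto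
  next
    case 3
    obtain z where z: "d + \<delta> < z" "z < d" "psi d - psi (d + \<delta>) = (d - (d + \<delta>)) * (psi z * (1 - psi z))"
      using MVT2[of "d + \<delta>" d psi "\<lambda>z. psi z * (1 - psi z)"] 3 DERIV_psi by auto
    have "\<bar>z\<bar> \<le> k + r" using d \<delta> z by linarith
    from slope[OF this] show ?thesis using z psi_variance_le[of z]
      by (intro that[of "psi z * (1 - psi z)"]) (auto simp: algebra_simps)
  qed
qed

lemma psi_monotone: "(psi s - psi t) * (s - t) \<ge> 0"
proof -
  obtain w where w: "psi (t + (s - t)) - psi t = w * (s - t)" "exp (- (\<bar>t\<bar> + \<bar>s - t\<bar>)) / 4 \<le> w"
    using psi_slope[of t "\<bar>t\<bar>" "s - t" "\<bar>s - t\<bar>"] by auto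
  have "0 \<le> w" using w(2) by (smt (verit) exp_gt_zero divide_pos_pos)
  thus ?thesis using w(1) by (simp add: mult.assoc)
qed

text \<open>
  The objective for arbitrary data \<open>Y\<close> and an arbitrary centre \<open>c\<close> of the regularisation. Both
  vary along the path from the true parameter to the estimator; the estimator itself has \<open>c = 0\<close>.
\<close>
definition reg_loss ::
    "nat \<Rightarrow> nat set set \<Rightarrow> (nat \<Rightarrow> nat \<Rightarrow> real) \<Rightarrow> (nat \<Rightarrow> real) \<Rightarrow> real \<Rightarrow> (nat \<Rightarrow> real) \<Rightarrow> real" where
  "reg_loss n E Y c \<rho> \<theta> =
     - (\<Sum>(i, j)\<in>pairs n. adj E i j * (Y i j * ln (psi (\<theta> i - \<theta> j)) + (1 - Y i j) * ln (1 - psi (\<theta> i - \<theta> j))))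
     + \<rho> / 2 * (\<Sum>i = 1..n. (\<theta> i - c i)\<^sup>2)"

definition centred :: "nat \<Rightarrow> (nat \<Rightarrow> real) set" where
  "centred n = {\<theta> \<in> {1..n} \<rightarrow>\<^sub>E UNIV. (\<Sum>i = 1..n. \<theta> i) = 0}"

lemma continuous_on_reg_loss: "continuous_on UNIV (reg_loss n E Y c \<rho>)"
proof -
  have psi: "continuous_on UNIV psi"
    using DERIV_psi by (intro continuous_at_imp_continuous_on ballI DERIV_isCont) blast
  have proj: "continuous_on UNIV (\<lambda>\<theta>. \<theta> i)" for i :: nat
    by (rule continuous_on_product_coordinates)
  have pd: "continuous_on UNIV (\<lambda>\<theta>::nat \<Rightarrow> real. psi (\<theta> i - \<theta> j))" for i j
    by (intro continuous_on_compose2[OF psi] continuous_on_diff proj) auto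
  have ne: "psi t \<noteq> 0" "psi t \<noteq> 1" for t using psi_bounds[of t] by auto
  show ?thesis unfolding reg_loss_def case_prod_unfold
    by (intro continuous_intros pd proj) (auto simp: ne)
qed

text \<open>
  The likelihood part is nonnegative, so the regularisation confines every competitor of the zero
  vector to a compact box.
\<close>
lemma reg_loss_minimiser_exists:
  assumes \<rho>: "\<rho> > 0" and Y: "\<And>i j. 0 \<le> Y i j \<and> Y i j \<le> 1"
  shows "\<exists>\<theta>\<in>centred n. \<forall>\<theta>'\<in>centred n. reg_loss n E Y c \<rho> \<theta> \<le> reg_loss n E Y c \<rho> \<theta>'"
proof -
  let ?F = "reg_loss n E Y c \<rho>"
  define z :: "nat \<Rightarrow> real" where "z = (\<lambda>i. if i \<in> {1..n} then 0 else undefined)"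
  have z: "z \<in> centred n" by (auto simp: z_def centred_def)
  have lik: "- (\<Sum>(i, j)\<in>pairs n. adj E i j * (Y i j * ln (psi (\<theta> i - \<theta> j)) + (1 - Y i j) * ln (1 - psi (\<theta> i - \<theta> j)))) \<ge> 0" for \<theta>
    unfolding sum_negf[symmetric]
  proof (intro sum_nonneg, clarify)
    fix i j
    have "Y i j * ln (psi (\<theta> i - \<theta> j)) \<le> 0" "(1 - Y i j) * ln (1 - psi (\<theta> i - \<theta> j)) \<le> 0"
      using Y[of i j] psi_bounds[of "\<theta> i - \<theta> j"] by (auto intro!: mult_nonneg_nonpos)
    hence "adj E i j * (Y i j * ln (psi (\<theta> i - \<theta> j)) + (1 - Y i j) * ln (1 - psi (\<theta> i - \<theta> j))) \<le> 0"
      by (intro mult_nonneg_nonpos) (auto simp: adj_def)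
    thus "0 \<le> - (adj E i j * (Y i j * ln (psi (\<theta> i - \<theta> j)) + (1 - Y i j) * ln (1 - psi (\<theta> i - \<theta> j))))" by simp
  qed
  have Fge: "\<rho> / 2 * (\<Sum>i = 1..n. (\<theta> i - c i)\<^sup>2) \<le> ?F \<theta>" for \<theta>
    using lik[of \<theta>] by (simp add: reg_loss_def)
  define M where "M = sqrt (2 * ?F z / \<rho>) + (\<Sum>i = 1..n. \<bar>c i\<bar>)"
  define K :: "(nat \<Rightarrow> real) set" where "K = PiE UNIV (\<lambda>i. if i \<in> {1..n} then {- M..M} else {undefined})"
  have inK: "\<theta> \<in> K" if \<theta>: "\<theta> \<in> centred n" "?F \<theta> \<le> ?F z" for \<theta>
  proof -
    have "\<bar>\<theta> i\<bar> \<le> M" if i: "i \<in> {1..n}" for i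
    proof -
      have "(\<theta> i - c i)\<^sup>2 \<le> (\<Sum>i = 1..n. (\<theta> i - c i)\<^sup>2)" using i by (intro member_le_sum) auto
      also have "\<dots> \<le> 2 * ?F z / \<rho>"
        using Fge[of \<theta>] \<theta>(2) \<rho> by (simp add: field_simps)
      finally have "\<bar>\<theta> i - c i\<bar> \<le> sqrt (2 * ?F z / \<rho>)" by (metis real_sqrt_abs real_sqrt_le_iff)
      moreover have "\<bar>c i\<bar> \<le> (\<Sum>i = 1..n. \<bar>c i\<bar>)"
        using i by (intro member_le_sum[of i "{1..n}" "\<lambda>i. \<bar>c i\<bar>"]) auto
      ultimately show ?thesis unfolding M_def by linarith
    qed
    thus ?thesis using \<theta>(1)
      by (auto simp: K_def centred_def PiE_def Pi_def extensional_def abs_le_iff minus_le_iff)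
  qed
  have "compact K"
  proof -
    have "compactin (product_topology (\<lambda>_. euclidean) UNIV) K"
      unfolding K_def compactin_PiE by (auto simp: compactin_euclidean_iff)
    thus ?thesis by (simp add: euclidean_product_topology compactin_euclidean_iff)
  qed
  moreover have "closed {\<theta>::nat \<Rightarrow> real. (\<Sum>i = 1..n. \<theta> i) = 0}"
    by (intro closed_Collect_eq continuous_intros continuous_on_product_coordinates)
  ultimately have comp: "compact (K \<inter> {\<theta>. (\<Sum>i = 1..n. \<theta> i) = 0})" by (rule compact_Int_closed)
  have zK: "z \<in> K \<inter> {\<theta>. (\<Sum>i = 1..n. \<theta> i) = 0}" using inK[OF z] z by (auto simp: centred_def)
  obtain \<theta> where \<theta>: "\<theta> \<in> K" "(\<Sum>i = 1..n. \<theta> i) = 0"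
      "\<And>\<theta>'. \<theta>' \<in> K \<Longrightarrow> (\<Sum>i = 1..n. \<theta>' i) = 0 \<Longrightarrow> ?F \<theta> \<le> ?F \<theta>'"
    using continuous_attains_inf[OF comp, of ?F] zK continuous_on_subset[OF continuous_on_reg_loss]
    by (metis (mono_tags, lifting) Int_iff emptyE mem_Collect_eq subset_UNIV)
  show ?thesis
  proof (intro bexI ballI)
    show "\<theta> \<in> centred n" using \<theta>(1,2) by (auto simp: centred_def K_def PiE_def Pi_def extensional_def split: if_splits)
    fix \<theta>' assume \<theta>': "\<theta>' \<in> centred n"
    show "?F \<theta> \<le> ?F \<theta>'"
    proof (cases "?F \<theta>' \<le> ?F z")
      case True
      thus ?thesis using \<theta>(3)[OF inK[OF \<theta>' True]] \<theta>' by (auto simp: centred_def)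
    next
      case False
      thus ?thesis using \<theta>(3)[of z] zK by auto
    qed
  qed
qed

lemma reg_loss_cong:
  assumes "\<And>i. i \<in> {1..n} \<Longrightarrow> \<theta> i = \<theta>' i"
  shows "reg_loss n E Y c \<rho> \<theta> = reg_loss n E Y c \<rho> \<theta>'"
proof -
  have "(\<Sum>i = 1..n. (\<theta> i - c i)\<^sup>2) = (\<Sum>i = 1..n. (\<theta>' i - c i)\<^sup>2)"
    using assms by (intro sum.cong) auto
  moreover have "(\<Sum>(i, j)\<in>pairs n. adj E i j * (Y i j * ln (psi (\<theta> i - \<theta> j)) + (1 - Y i j) * ln (1 - psi (\<theta> i - \<theta> j))))
    = (\<Sum>(i, j)\<in>pairs n. adj E i j * (Y i j * ln (psi (\<theta>' i - \<theta>' j)) + (1 - Y i j) * ln (1 - psi (\<theta>' i - \<theta>' j))))"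
    using assms by (intro sum.cong refl) (auto simp: pairs_def)
  ultimately show ?thesis by (simp add: reg_loss_def)
qed

lemma reg_loss_directional_derivative:
  "((\<lambda>s. reg_loss n E Y c \<rho> (\<lambda>i. \<theta> i + s * u i)) has_real_derivative
      (\<Sum>i = 1..n. u i * (score n E Y \<theta> i + \<rho> * (\<theta> i - c i)))) (at 0)"
proof -
  have lik: "((\<lambda>s. A * (Y' * ln (psi (d + s * e)) + (1 - Y') * ln (1 - psi (d + s * e)))) has_real_derivative
      - (A * (psi d - Y') * e)) (at 0)" for A Y' d e
  proof -
    have p: "psi d > 0" "1 - psi d > 0" using psi_bounds[of d] by auto
    have der: "((\<lambda>s. psi (d + s * e)) has_real_derivative psi d * (1 - psi d) * e) (at 0)"
      by (rule DERIV_chain2[OF DERIV_psi, THEN DERIV_cong]) (auto intro!: derivative_eq_intros)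
    have "((\<lambda>s. ln (psi (d + s * e))) has_real_derivative (1 - psi d) * e) (at 0)"
      by (rule DERIV_cong[OF DERIV_chain2[OF DERIV_ln_divide der]]) (use p in auto)
    moreover have "((\<lambda>s. ln (1 - psi (d + s * e))) has_real_derivative - (psi d * e)) (at 0)"
      by (rule DERIV_cong[OF DERIV_chain2[OF DERIV_ln_divide DERIV_diff[OF DERIV_const der]]]) (use p in auto)
    ultimately have "((\<lambda>s. A * (Y' * ln (psi (d + s * e)) + (1 - Y') * ln (1 - psi (d + s * e)))) has_real_derivative
      A * (Y' * ((1 - psi d) * e) + (1 - Y') * (- (psi d * e)))) (at 0)"
      by (intro DERIV_cmult DERIV_add)
    thus ?thesis by (rule DERIV_cong) (simp add: algebra_simps)
  qed
  have "((\<lambda>s. reg_loss n E Y c \<rho> (\<lambda>i. \<theta> i + s * u i)) has_real_derivative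
     - (\<Sum>(i, j)\<in>pairs n. - (adj E i j * (psi (\<theta> i - \<theta> j) - Y i j) * (u i - u j)))
      + \<rho> / 2 * (\<Sum>i = 1..n. 2 * (\<theta> i - c i) * u i)) (at 0)"
    unfolding reg_loss_def case_prod_unfold
  proof (intro DERIV_add DERIV_minus DERIV_sum DERIV_cmult, goal_cases)
    case (1 x)
    have "(\<lambda>s. adj E (fst x) (snd x) * (Y (fst x) (snd x) * ln (psi (\<theta> (fst x) + s * u (fst x) - (\<theta> (snd x) + s * u (snd x))))
           + (1 - Y (fst x) (snd x)) * ln (1 - psi (\<theta> (fst x) + s * u (fst x) - (\<theta> (snd x) + s * u (snd x))))))
        = (\<lambda>s. adj E (fst x) (snd x) * (Y (fst x) (snd x) * ln (psi ((\<theta> (fst x) - \<theta> (snd x)) + s * (u (fst x) - u (snd x))))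
           + (1 - Y (fst x) (snd x)) * ln (1 - psi ((\<theta> (fst x) - \<theta> (snd x)) + s * (u (fst x) - u (snd x))))))"
      by (simp add: algebra_simps)
    thus ?case using lik by simp
  next
    case (2 i)
    show ?case by (auto intro!: derivative_eq_intros)
  qed
  also have "- (\<Sum>(i, j)\<in>pairs n. - (adj E i j * (psi (\<theta> i - \<theta> j) - Y i j) * (u i - u j)))
      = (\<Sum>i = 1..n. u i * score n E Y \<theta> i)"
    unfolding score_inner sum_negf[symmetric] by (intro sum.cong) auto
  also have "\<rho> / 2 * (\<Sum>i = 1..n. 2 * (\<theta> i - c i) * u i) = (\<Sum>i = 1..n. u i * (\<rho> * (\<theta> i - c i)))"
    unfolding sum_distrib_left by (intro sum.cong) auto
  finally show ?thesis by (simp add: sum.distrib[symmetric] ring_distribs)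
qed

text \<open>
  Under the constraint \<open>\<Sum>\<theta> = 0\<close> one expects a Lagrange multiplier, but it vanishes: the
  gradient \<open>T\<close> itself sums to zero, as the scores do by antisymmetry. Hence \<open>T\<close> is a feasible
  direction, and the derivative in this direction is \<open>\<Sum>T\<^sup>2\<close>.
\<close>
lemma minimiser_score_equation:
  assumes \<theta>: "\<theta> \<in> centred n" and min: "\<And>\<theta>'. \<theta>' \<in> centred n \<Longrightarrow> reg_loss n E Y c \<rho> \<theta> \<le> reg_loss n E Y c \<rho> \<theta>'"
    and c: "(\<Sum>i = 1..n. c i) = 0" and i: "i \<in> {1..n}"
  shows "score n E Y \<theta> i + \<rho> * (\<theta> i - c i) = 0"
proof -
  define T where "T i = score n E Y \<theta> i + \<rho> * (\<theta> i - c i)" for i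
  have "(\<Sum>i = 1..n. 1 * score n E Y \<theta> i) = 0" unfolding score_inner by simp
  moreover have "(\<Sum>i = 1..n. \<rho> * (\<theta> i - c i)) = 0"
    using c \<theta> unfolding sum_distrib_left[symmetric] sum_subtractf by (simp add: centred_def)
  ultimately have T0: "(\<Sum>i = 1..n. T i) = 0" by (simp add: T_def sum.distrib)
  have "(\<Sum>i = 1..n. T i * T i) = 0"
  proof (rule DERIV_local_min[OF _ zero_less_one])
    show "((\<lambda>s. reg_loss n E Y c \<rho> (\<lambda>i. \<theta> i + s * T i)) has_real_derivative (\<Sum>i = 1..n. T i * T i)) (at 0)"
      unfolding T_def by (rule reg_loss_directional_derivative)
    show "\<forall>s. \<bar>0 - s\<bar> < 1 \<longrightarrow> reg_loss n E Y c \<rho> (\<lambda>i. \<theta> i + 0 * T i) \<le> reg_loss n E Y c \<rho> (\<lambda>i. \<theta> i + s * T i)"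
    proof (intro allI impI)
      fix s
      let ?\<theta> = "\<lambda>i. if i \<in> {1..n} then \<theta> i + s * T i else undefined"
      have "?\<theta> \<in> centred n"
        using \<theta> T0 by (auto simp: centred_def sum.distrib sum_distrib_left[symmetric])
      hence "reg_loss n E Y c \<rho> \<theta> \<le> reg_loss n E Y c \<rho> ?\<theta>" by (rule min)
      also have "\<dots> = reg_loss n E Y c \<rho> (\<lambda>i. \<theta> i + s * T i)" by (rule reg_loss_cong) auto
      finally show "reg_loss n E Y c \<rho> (\<lambda>i. \<theta> i + 0 * T i) \<le> reg_loss n E Y c \<rho> (\<lambda>i. \<theta> i + s * T i)" by simp
    qed
  qed
  hence "T i * T i = 0" using i by (subst (asm) sum_nonneg_eq_0_iff) auto
  thus ?thesis by (simp add: T_def)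
qed

section \<open>The path from the true parameter to the estimator\<close>

text \<open>
  The score equation at time \<open>t\<close> of the path, solved for the deviation from \<open>\<theta>\<^sub>0\<close>. In the
  application \<open>h\<close> is the gradient of the regularised loss at \<open>\<theta>\<^sub>0\<close>. The equation is used instead
  of minimality because it determines the point when \<open>\<rho> > 0\<close>.
\<close>
definition on_path ::
    "nat \<Rightarrow> nat set set \<Rightarrow> real \<Rightarrow> (nat \<Rightarrow> real) \<Rightarrow> (nat \<Rightarrow> real) \<Rightarrow> real \<Rightarrow> (nat \<Rightarrow> real) \<Rightarrow> bool" where
  "on_path n E \<rho> \<theta>\<^sub>0 h t \<theta> \<longleftrightarrow> (\<Sum>i = 1..n. \<theta> i) = 0 \<and>
     (\<forall>i\<in>{1..n}. (\<Sum>b = 1..n. adj E i b * (psi (\<theta> i - \<theta> b) - psi (\<theta>\<^sub>0 i - \<theta>\<^sub>0 b)))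
                    + \<rho> * (\<theta> i - \<theta>\<^sub>0 i) = - (t * h i))"

text \<open>
  Interpolating the data between the model probabilities at \<open>\<theta>\<^sub>0\<close> and \<open>Y\<close> scales the noise
  by \<open>t\<close>.
\<close>
lemma score_interpolate:
  "score n E (\<lambda>a b. (1 - t) * psi (\<theta>\<^sub>0 a - \<theta>\<^sub>0 b) + t * Y a b) \<theta> i =
     (\<Sum>b = 1..n. adj E i b * (psi (\<theta> i - \<theta> b) - psi (\<theta>\<^sub>0 i - \<theta>\<^sub>0 b))) + t * score n E Y \<theta>\<^sub>0 i"
  unfolding score_def sum_distrib_left sum.distrib[symmetric]
proof (intro sum.cong refl)
  fix b
  have u: "psi (x - y) = 1 - psi (y - x)" for x y using psi_uminus[of "y - x"] by simp
  have res: "residual (\<lambda>a b. (1 - t) * psi (\<theta>\<^sub>0 a - \<theta>\<^sub>0 b) + t * Y a b) \<theta> i b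
     = psi (\<theta> i - \<theta> b) - psi (\<theta>\<^sub>0 i - \<theta>\<^sub>0 b) + t * residual Y \<theta>\<^sub>0 i b"
    using u[of "\<theta> i" "\<theta> b"] u[of "\<theta>\<^sub>0 i" "\<theta>\<^sub>0 b"] by (auto simp: residual_def algebra_simps)
  show "adj E i b * residual (\<lambda>a b. (1 - t) * psi (\<theta>\<^sub>0 a - \<theta>\<^sub>0 b) + t * Y a b) \<theta> i b
     = adj E i b * (psi (\<theta> i - \<theta> b) - psi (\<theta>\<^sub>0 i - \<theta>\<^sub>0 b)) + t * (adj E i b * residual Y \<theta>\<^sub>0 i b)"
    unfolding res by (simp only: distrib_left mult.left_commute)
qed

lemma psi_diff_antisym:
  "adj E b a * (psi (\<theta> b - \<theta> a) - psi (\<theta>' b - \<theta>' a)) = - (adj E a b * (psi (\<theta> a - \<theta> b) - psi (\<theta>' a - \<theta>' b)))"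
proof -
  have "psi (\<theta> b - \<theta> a) - psi (\<theta>' b - \<theta>' a) = - (psi (\<theta> a - \<theta> b) - psi (\<theta>' a - \<theta>' b))"
    using psi_uminus[of "\<theta> a - \<theta> b"] psi_uminus[of "\<theta>' a - \<theta>' b"] by simp
  thus ?thesis by (simp only: adj_commute[of E b a] mult_minus_right)
qed

lemma minimiser_on_path:
  assumes \<theta>: "\<theta> \<in> centred n"
    and min: "\<And>\<theta>'. \<theta>' \<in> centred n \<Longrightarrow>
       reg_loss n E (\<lambda>a b. (1 - t) * psi (\<theta>\<^sub>0 a - \<theta>\<^sub>0 b) + t * Y a b) (\<lambda>i. (1 - t) * \<theta>\<^sub>0 i) \<rho> \<theta>
       \<le> reg_loss n E (\<lambda>a b. (1 - t) * psi (\<theta>\<^sub>0 a - \<theta>\<^sub>0 b) + t * Y a b) (\<lambda>i. (1 - t) * \<theta>\<^sub>0 i) \<rho> \<theta>'"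
    and c: "(\<Sum>i = 1..n. \<theta>\<^sub>0 i) = 0"
  shows "on_path n E \<rho> \<theta>\<^sub>0 (\<lambda>i. score n E Y \<theta>\<^sub>0 i + \<rho> * \<theta>\<^sub>0 i) t \<theta>"
  unfolding on_path_def
proof (intro conjI ballI)
  show "(\<Sum>i = 1..n. \<theta> i) = 0" using \<theta> by (simp add: centred_def)
  fix i assume i: "i \<in> {1..n}"
  have c': "(\<Sum>i = 1..n. (1 - t) * \<theta>\<^sub>0 i) = 0" using c by (simp add: sum_distrib_left[symmetric])
  show "(\<Sum>b = 1..n. adj E i b * (psi (\<theta> i - \<theta> b) - psi (\<theta>\<^sub>0 i - \<theta>\<^sub>0 b))) + \<rho> * (\<theta> i - \<theta>\<^sub>0 i)
     = - (t * (score n E Y \<theta>\<^sub>0 i + \<rho> * \<theta>\<^sub>0 i))"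
    using minimiser_score_equation[OF \<theta> min c' i, unfolded score_interpolate] by (simp add: algebra_simps)
qed

lemma path_exists:
  assumes \<rho>: "\<rho> > 0" and Y: "\<And>i j. 0 \<le> Y i j \<and> Y i j \<le> 1" and c: "(\<Sum>i = 1..n. \<theta>\<^sub>0 i) = 0"
    and t: "0 \<le> t" "t \<le> 1"
  shows "\<exists>\<theta>. on_path n E \<rho> \<theta>\<^sub>0 (\<lambda>i. score n E Y \<theta>\<^sub>0 i + \<rho> * \<theta>\<^sub>0 i) t \<theta>"
proof -
  let ?Y = "\<lambda>i j. (1 - t) * psi (\<theta>\<^sub>0 i - \<theta>\<^sub>0 j) + t * Y i j"
  have Yt: "0 \<le> ?Y i j \<and> ?Y i j \<le> 1" for i j
    using t Y[of i j] psi_bounds[of "\<theta>\<^sub>0 i - \<theta>\<^sub>0 j"] by (auto intro!: convex_bound_le)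
  obtain \<theta> where "\<theta> \<in> centred n" "\<And>\<theta>'. \<theta>' \<in> centred n \<Longrightarrow>
      reg_loss n E ?Y (\<lambda>i. (1 - t) * \<theta>\<^sub>0 i) \<rho> \<theta> \<le> reg_loss n E ?Y (\<lambda>i. (1 - t) * \<theta>\<^sub>0 i) \<rho> \<theta>'"
    using reg_loss_minimiser_exists[where Y = ?Y, OF \<rho> Yt] by blast
  from minimiser_on_path[OF this c] show ?thesis by blast
qed

lemma L2_set_square: "(L2_set f A)\<^sup>2 = (\<Sum>i\<in>A. (f i)\<^sup>2)"
  by (simp add: L2_set_def sum_nonneg)

lemma inner_le_L2_set: "\<bar>\<Sum>i\<in>A. f i * g i\<bar> \<le> L2_set f A * L2_set g A"
proof -
  have "\<bar>\<Sum>i\<in>A. f i * g i\<bar> \<le> (\<Sum>i\<in>A. \<bar>f i\<bar> * \<bar>g i\<bar>)"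
    by (rule order_trans[OF sum_abs]) (simp add: abs_mult)
  also have "\<dots> \<le> L2_set f A * L2_set g A" by (rule L2_set_mult_ineq)
  finally show ?thesis .
qed

lemma abs_le_L2_set: "finite A \<Longrightarrow> i \<in> A \<Longrightarrow> \<bar>f i\<bar> \<le> L2_set f A"
  using member_le_L2_set[of A i "\<lambda>i. \<bar>f i\<bar>"] by (simp add: L2_set_def)

text \<open>
  Subtract the equations at the two times and test with the difference \<open>\<delta>\<close> of the solutions. The
  likelihood part is nonnegative because \<open>\<psi>\<close> is increasing, which leaves \<open>\<rho> \<parallel>\<delta>\<parallel>\<^sup>2\<close>. The
  case \<open>s = t\<close> is uniqueness.
\<close>
lemma path_lipschitz:
  assumes s: "on_path n E \<rho> \<theta>\<^sub>0 h s \<theta>" and t: "on_path n E \<rho> \<theta>\<^sub>0 h t \<theta>'"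
  shows "\<rho> * L2_set (\<lambda>i. \<theta> i - \<theta>' i) {1..n} \<le> \<bar>s - t\<bar> * L2_set h {1..n}"
proof -
  define \<delta> where "\<delta> i = \<theta> i - \<theta>' i" for i
  define \<phi> where "\<phi> a b = adj E a b * (psi (\<theta> a - \<theta> b) - psi (\<theta>' a - \<theta>' b))" for a b
  have eq: "(\<Sum>b = 1..n. \<phi> i b) + \<rho> * \<delta> i = (t - s) * h i" if "i \<in> {1..n}" for i
  proof -
    have "(\<Sum>b = 1..n. \<phi> i b) = (\<Sum>b = 1..n. adj E i b * (psi (\<theta> i - \<theta> b) - psi (\<theta>\<^sub>0 i - \<theta>\<^sub>0 b)))
         - (\<Sum>b = 1..n. adj E i b * (psi (\<theta>' i - \<theta>' b) - psi (\<theta>\<^sub>0 i - \<theta>\<^sub>0 b)))"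
      unfolding sum_subtractf[symmetric] \<phi>_def by (simp add: algebra_simps)
    moreover have "(\<Sum>b = 1..n. adj E i b * (psi (\<theta> i - \<theta> b) - psi (\<theta>\<^sub>0 i - \<theta>\<^sub>0 b))) = - (s * h i) - \<rho> * (\<theta> i - \<theta>\<^sub>0 i)"
      using s that unfolding on_path_def by (simp add: eq_diff_eq)
    moreover have "(\<Sum>b = 1..n. adj E i b * (psi (\<theta>' i - \<theta>' b) - psi (\<theta>\<^sub>0 i - \<theta>\<^sub>0 b))) = - (t * h i) - \<rho> * (\<theta>' i - \<theta>\<^sub>0 i)"
      using t that unfolding on_path_def by (simp add: eq_diff_eq)
    ultimately show ?thesis by (simp add: \<delta>_def algebra_simps)
  qed
  have "0 \<le> (\<Sum>(a, b)\<in>pairs n. \<phi> a b * (\<delta> a - \<delta> b))"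
  proof (intro sum_nonneg, clarify)
    fix a b
    have "0 \<le> (psi (\<theta> a - \<theta> b) - psi (\<theta>' a - \<theta>' b)) * (\<delta> a - \<delta> b)"
      using psi_monotone[of "\<theta> a - \<theta> b" "\<theta>' a - \<theta>' b"] by (simp add: \<delta>_def algebra_simps)
    thus "0 \<le> \<phi> a b * (\<delta> a - \<delta> b)" by (simp add: \<phi>_def mult.assoc adj_def)
  qed
  also have "\<dots> = (\<Sum>i = 1..n. \<delta> i * (\<Sum>b = 1..n. \<phi> i b))"
    unfolding \<phi>_def by (rule sum_pairs_antisym) (rule psi_diff_antisym)
  finally have pos: "0 \<le> (\<Sum>i = 1..n. \<delta> i * (\<Sum>b = 1..n. \<phi> i b))" .
  have "\<rho> * (L2_set \<delta> {1..n})\<^sup>2 = (\<Sum>i = 1..n. \<rho> * (\<delta> i)\<^sup>2)"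
    by (simp add: L2_set_square sum_distrib_left)
  also have "\<dots> \<le> (\<Sum>i = 1..n. \<delta> i * (\<Sum>b = 1..n. \<phi> i b)) + (\<Sum>i = 1..n. \<rho> * (\<delta> i)\<^sup>2)" using pos by simp
  also have "\<dots> = (\<Sum>i = 1..n. \<delta> i * ((\<Sum>b = 1..n. \<phi> i b) + \<rho> * \<delta> i))"
    by (simp add: sum.distrib[symmetric] power2_eq_square ring_distribs mult_ac)
  also have "\<dots> = (\<Sum>i = 1..n. \<delta> i * ((t - s) * h i))" by (intro sum.cong refl) (simp only: eq)
  also have "\<dots> = (t - s) * (\<Sum>i = 1..n. \<delta> i * h i)" by (simp add: sum_distrib_left mult_ac)
  also have "\<dots> \<le> \<bar>s - t\<bar> * (L2_set \<delta> {1..n} * L2_set h {1..n})"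
  proof -
    have "(t - s) * (\<Sum>i = 1..n. \<delta> i * h i) \<le> \<bar>t - s\<bar> * \<bar>\<Sum>i = 1..n. \<delta> i * h i\<bar>"
      by (metis abs_ge_self abs_mult)
    also have "\<dots> \<le> \<bar>t - s\<bar> * (L2_set \<delta> {1..n} * L2_set h {1..n})"
      by (intro mult_left_mono inner_le_L2_set) auto
    finally show ?thesis by (simp add: abs_minus_commute)
  qed
  finally have *: "L2_set \<delta> {1..n} * (\<rho> * L2_set \<delta> {1..n}) \<le> L2_set \<delta> {1..n} * (\<bar>s - t\<bar> * L2_set h {1..n})"
    by (simp add: power2_eq_square mult_ac)
  show ?thesis
  proof (cases "L2_set \<delta> {1..n} = 0")
    case True thus ?thesis unfolding \<delta>_def by (simp add: L2_set_nonneg)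
  next
    case False
    hence "L2_set \<delta> {1..n} > 0" using L2_set_nonneg[of \<delta> "{1..n}"] by linarith
    from mult_left_le_imp_le[OF * this] show ?thesis unfolding \<delta>_def .
  qed
qed

text \<open>
  Near \<open>\<theta>\<^sub>0\<close> the equation is a Laplacian system for \<open>\<Delta> = \<theta> - \<theta>\<^sub>0\<close> with edge weights
  \<open>w \<in> {m..1/4}\<close>. The first bound tests the system with \<open>\<Delta>\<close>; the second isolates \<open>\<Delta>\<^sub>i\<close> in
  its \<open>i\<close>-th coordinate and estimates the contribution of the neighbours by Cauchy--Schwarz.
\<close>
lemma path_local_bound:
  assumes ex: "expanding n p E" and n: "2 \<le> n" and np: "real n * p > 0"
    and k: "\<And>a b. {a, b} \<in> E \<Longrightarrow> \<bar>\<theta>\<^sub>0 a - \<theta>\<^sub>0 b\<bar> \<le> k"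
    and \<theta>\<^sub>0: "(\<Sum>i = 1..n. \<theta>\<^sub>0 i) = 0" and \<rho>: "\<rho> \<ge> 0" and t: "0 \<le> t" "t \<le> 1"
    and path: "on_path n E \<rho> \<theta>\<^sub>0 h t \<theta>"
    and near: "\<And>i. i \<in> {1..n} \<Longrightarrow> \<bar>\<theta> i - \<theta>\<^sub>0 i\<bar> \<le> 1"
  defines "m \<equiv> exp (- (k + 2)) / 4"
  shows "L2_set (\<lambda>i. \<theta> i - \<theta>\<^sub>0 i) {1..n} \<le> 96 * L2_set h {1..n} / (m * (real n * p))"
    and "\<And>i. i \<in> {1..n} \<Longrightarrow> \<bar>\<theta> i - \<theta>\<^sub>0 i\<bar> \<le>
           4 / (m * (real n * p)) * (sqrt (3 * (real n * p)) / 4 * L2_set (\<lambda>i. \<theta> i - \<theta>\<^sub>0 i) {1..n} + \<bar>h i\<bar>)"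
proof -
  define q where "q = real n * p"
  have q: "q > 0" using np by (simp add: q_def)
  have m: "m > 0" by (simp add: m_def)
  define \<Delta> where "\<Delta> i = \<theta> i - \<theta>\<^sub>0 i" for i
  define N where "N = L2_set \<Delta> {1..n}"
  have N: "N \<ge> 0" by (simp add: N_def L2_set_nonneg)
  have "\<exists>w. \<forall>a b. {a, b} \<in> E \<and> a \<in> {1..n} \<and> b \<in> {1..n} \<longrightarrow>
      psi (\<theta> a - \<theta> b) - psi (\<theta>\<^sub>0 a - \<theta>\<^sub>0 b) = w a b * (\<Delta> a - \<Delta> b) \<and> m \<le> w a b \<and> w a b \<le> 1 / 4"
  proof -
    have "\<exists>w. {a, b} \<in> E \<and> a \<in> {1..n} \<and> b \<in> {1..n} \<longrightarrow>
      psi (\<theta> a - \<theta> b) - psi (\<theta>\<^sub>0 a - \<theta>\<^sub>0 b) = w * (\<Delta> a - \<Delta> b) \<and> m \<le> w \<and> w \<le> 1 / 4" for a b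
    proof (cases "{a, b} \<in> E \<and> a \<in> {1..n} \<and> b \<in> {1..n}")
      case True
      hence "\<bar>\<Delta> a - \<Delta> b\<bar> \<le> 2" using near[of a] near[of b] by (auto simp: \<Delta>_def)
      moreover have "\<bar>\<theta>\<^sub>0 a - \<theta>\<^sub>0 b\<bar> \<le> k" using k True by blast
      ultimately obtain w where "psi ((\<theta>\<^sub>0 a - \<theta>\<^sub>0 b) + (\<Delta> a - \<Delta> b)) - psi (\<theta>\<^sub>0 a - \<theta>\<^sub>0 b) = w * (\<Delta> a - \<Delta> b)"
          "exp (- (k + 2)) / 4 \<le> w" "w \<le> 1 / 4" using psi_slope by blast
      thus ?thesis by (intro exI[of _ w]) (auto simp: m_def \<Delta>_def)
    qed auto
    thus ?thesis by metis
  qed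
  then obtain w where w: "\<And>a b. {a, b} \<in> E \<Longrightarrow> a \<in> {1..n} \<Longrightarrow> b \<in> {1..n} \<Longrightarrow>
      psi (\<theta> a - \<theta> b) - psi (\<theta>\<^sub>0 a - \<theta>\<^sub>0 b) = w a b * (\<Delta> a - \<Delta> b) \<and> m \<le> w a b \<and> w a b \<le> 1 / 4"
    by blast
  define \<phi> where "\<phi> a b = adj E a b * (psi (\<theta> a - \<theta> b) - psi (\<theta>\<^sub>0 a - \<theta>\<^sub>0 b))" for a b
  have eq: "(\<Sum>b = 1..n. \<phi> i b) + \<rho> * \<Delta> i = - (t * h i)" if "i \<in> {1..n}" for i
    using path that by (simp add: on_path_def \<phi>_def \<Delta>_def)
  have sum\<Delta>: "(\<Sum>i = 1..n. \<Delta> i) = 0" using path \<theta>\<^sub>0 by (simp add: \<Delta>_def sum_subtractf on_path_def)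
  have "m * (q / 96) * N\<^sup>2 = m / 2 * (q / 48 * (\<Sum>i = 1..n. (\<Delta> i)\<^sup>2))"
    by (simp add: N_def L2_set_square)
  also have "\<dots> \<le> m / 2 * (\<Sum>a = 1..n. \<Sum>b = 1..n. adj E a b * (\<Delta> a - \<Delta> b)\<^sup>2)"
    using m unfolding q_def by (intro mult_left_mono expanding_spectral_gap[OF ex np sum\<Delta>]) auto
  also have "\<dots> = (\<Sum>(a, b)\<in>pairs n. m * (adj E a b * (\<Delta> a - \<Delta> b)\<^sup>2))"
    unfolding sum_square_eq_sum_pairs
    by (simp add: sum_distrib_left case_prod_unfold adj_commute[of E "snd _" "fst _"] power2_commute[of "\<Delta> (snd _)" "\<Delta> (fst _)"])
  also have "\<dots> \<le> (\<Sum>(a, b)\<in>pairs n. \<phi> a b * (\<Delta> a - \<Delta> b))"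
  proof (intro sum_mono, clarify)
    fix a b assume ab: "(a, b) \<in> pairs n"
    show "m * (adj E a b * (\<Delta> a - \<Delta> b)\<^sup>2) \<le> \<phi> a b * (\<Delta> a - \<Delta> b)"
    proof (cases "{a, b} \<in> E")
      case True
      have "m * (\<Delta> a - \<Delta> b)\<^sup>2 \<le> w a b * (\<Delta> a - \<Delta> b)\<^sup>2"
        using w[OF True] ab by (intro mult_right_mono) (auto simp: pairs_def)
      thus ?thesis using w[OF True] ab True
        by (simp add: \<phi>_def adj_def pairs_def power2_eq_square)
    qed (simp add: \<phi>_def adj_def)
  qed
  also have "\<dots> = (\<Sum>i = 1..n. \<Delta> i * (\<Sum>b = 1..n. \<phi> i b))"
    unfolding \<phi>_def by (rule sum_pairs_antisym) (rule psi_diff_antisym)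
  also have "\<dots> = (\<Sum>i = 1..n. - (t * (\<Delta> i * h i)) - \<rho> * (\<Delta> i)\<^sup>2)"
  proof (intro sum.cong refl)
    fix i assume "i \<in> {1..n}"
    hence S: "(\<Sum>b = 1..n. \<phi> i b) = - (t * h i) - \<rho> * \<Delta> i" using eq[of i] by linarith
    show "\<Delta> i * (\<Sum>b = 1..n. \<phi> i b) = - (t * (\<Delta> i * h i)) - \<rho> * (\<Delta> i)\<^sup>2"
      unfolding S by (simp add: power2_eq_square algebra_simps)
  qed
  also have "\<dots> = - t * (\<Sum>i = 1..n. \<Delta> i * h i) - \<rho> * N\<^sup>2"
    by (simp add: sum_subtractf sum_negf sum_distrib_left N_def L2_set_square)
  also have "\<dots> \<le> 1 * (N * L2_set h {1..n})"
  proof -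
    have "- t * (\<Sum>i = 1..n. \<Delta> i * h i) \<le> \<bar>t\<bar> * \<bar>\<Sum>i = 1..n. \<Delta> i * h i\<bar>"
      by (metis abs_ge_self abs_minus_cancel abs_mult mult_minus_left)
    also have "\<dots> \<le> 1 * (N * L2_set h {1..n})"
      unfolding N_def using t by (intro mult_mono inner_le_L2_set) auto
    finally show ?thesis using \<rho> zero_le_power2[of N] mult_nonneg_nonneg[of \<rho> "N\<^sup>2"] by linarith
  qed
  finally have *: "N * (m * q * N) \<le> N * (96 * L2_set h {1..n})"
    by (simp add: power2_eq_square field_simps)
  have "m * q * N \<le> 96 * L2_set h {1..n}"
  proof (cases "N = 0")
    case True thus ?thesis by (simp add: L2_set_nonneg)
  next
    case False
    from mult_left_le_imp_le[OF *] show ?thesis using False N by simp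
  qed
  thus L2: "L2_set (\<lambda>i. \<theta> i - \<theta>\<^sub>0 i) {1..n} \<le> 96 * L2_set h {1..n} / (m * (real n * p))"
    using m q unfolding N_def \<Delta>_def q_def by (simp add: field_simps)
  fix i assume i: "i \<in> {1..n}"
  define W where "W = (\<Sum>b = 1..n. adj E i b * w i b)"
  have "(\<Sum>b = 1..n. \<phi> i b) = (\<Sum>b = 1..n. adj E i b * w i b * (\<Delta> i - \<Delta> b))"
  proof (intro sum.cong refl)
    fix b assume "b \<in> {1..n}"
    thus "\<phi> i b = adj E i b * w i b * (\<Delta> i - \<Delta> b)" using w[of i b] i by (simp add: \<phi>_def adj_def)
  qed
  also have "\<dots> = W * \<Delta> i - (\<Sum>b = 1..n. adj E i b * w i b * \<Delta> b)"
    by (simp add: W_def sum_distrib_right sum_subtractf ring_distribs)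
  finally have split: "(W + \<rho>) * \<Delta> i = (\<Sum>b = 1..n. adj E i b * w i b * \<Delta> b) - t * h i"
    using eq[OF i] by (simp add: algebra_simps)
  have "m * (q / 4) \<le> m * (\<Sum>b = 1..n. adj E i b)"
    unfolding q_def using m by (intro mult_left_mono expanding_degree_lower[OF ex n i]) auto
  also have "\<dots> = (\<Sum>b = 1..n. m * adj E i b)" by (rule sum_distrib_left)
  also have "\<dots> \<le> W" unfolding W_def
  proof (intro sum_mono)
    fix b assume "b \<in> {1..n}"
    thus "m * adj E i b \<le> adj E i b * w i b" using w[of i b] i by (simp add: adj_def)
  qed
  finally have W: "m * (q / 4) \<le> W" .
  have "m * (q / 4) * \<bar>\<Delta> i\<bar> \<le> (W + \<rho>) * \<bar>\<Delta> i\<bar>" using W \<rho> by (intro mult_right_mono) auto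
  also have "\<dots> = \<bar>(W + \<rho>) * \<Delta> i\<bar>"
  proof -
    have "0 \<le> m * (q / 4)" using m q by simp
    hence "0 \<le> W + \<rho>" using W \<rho> by linarith
    thus ?thesis by (simp add: abs_mult)
  qed
  also have "\<dots> \<le> \<bar>\<Sum>b = 1..n. adj E i b * w i b * \<Delta> b\<bar> + \<bar>t * h i\<bar>"
    unfolding split by (rule abs_triangle_ineq4)
  also have "\<bar>t * h i\<bar> \<le> \<bar>h i\<bar>" using t by (simp add: abs_mult mult_left_le_one_le)
  also have "\<bar>\<Sum>b = 1..n. adj E i b * w i b * \<Delta> b\<bar> \<le> L2_set (\<lambda>b. adj E i b * w i b) {1..n} * N"
    unfolding N_def by (rule inner_le_L2_set)
  also have "L2_set (\<lambda>b. adj E i b * w i b) {1..n} \<le> sqrt (3 * q) / 4"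
  proof -
    have "(L2_set (\<lambda>b. adj E i b * w i b) {1..n})\<^sup>2 = (\<Sum>b = 1..n. (adj E i b * w i b)\<^sup>2)"
      by (rule L2_set_square)
    also have "\<dots> \<le> (\<Sum>b = 1..n. adj E i b * (1 / 16))"
    proof (intro sum_mono)
      fix b assume b: "b \<in> {1..n}"
      show "(adj E i b * w i b)\<^sup>2 \<le> adj E i b * (1 / 16)"
      proof (cases "{i, b} \<in> E")
        case True
        hence "0 \<le> w i b" "w i b \<le> 1 / 4" using w[OF True i b] m by auto
        hence "(w i b)\<^sup>2 \<le> (1 / 4)\<^sup>2" by (intro power_mono) auto
        thus ?thesis using True by (simp add: adj_def power2_eq_square)
      qed (simp add: adj_def)
    qed
    also have "\<dots> = (\<Sum>b = 1..n. adj E i b) * (1 / 16)" by (rule sum_distrib_right[symmetric])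
    also have "\<dots> \<le> 3 * q * (1 / 16)" unfolding q_def by (intro mult_right_mono expandingD(3)[OF ex i]) auto
    also have "\<dots> = (sqrt (3 * q) / 4)\<^sup>2" using q by (simp add: power_divide)
    finally show ?thesis by (rule power2_le_imp_le) (use q in simp)
  qed
  finally have "m * (q / 4) * \<bar>\<Delta> i\<bar> \<le> sqrt (3 * q) / 4 * N + \<bar>h i\<bar>" using N by (simp add: mult_right_mono)
  moreover have "m * (q / 4) > 0" using m q by simp
  ultimately have "\<bar>\<Delta> i\<bar> \<le> (sqrt (3 * q) / 4 * N + \<bar>h i\<bar>) / (m * (q / 4))"
    by (subst pos_le_divide_eq) (simp_all add: mult.commute)
  also have "\<dots> = 4 / (m * q) * (sqrt (3 * q) / 4 * N + \<bar>h i\<bar>)" by simp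
  finally show "\<bar>\<theta> i - \<theta>\<^sub>0 i\<bar> \<le> 4 / (m * (real n * p)) * (sqrt (3 * (real n * p)) / 4 * L2_set (\<lambda>i. \<theta> i - \<theta>\<^sub>0 i) {1..n} + \<bar>h i\<bar>)"
    unfolding q_def[symmetric] \<Delta>_def[symmetric] N_def[symmetric] .
qed

text \<open>
  The continuity argument, carried out on a time grid so fine that one step moves each coordinate by at
  most \<open>1 / 2\<close>. If the solution at one grid point is within \<open>\<beta> \<le> 1 / 2\<close> of \<open>\<theta>\<^sub>0\<close>, the
  next one is within \<open>1\<close>, and the local bound brings it back to within \<open>\<beta>\<close>.
\<close>
lemma path_endpoint_bound:
  assumes ex: "expanding n p E" and n: "2 \<le> n" and np: "real n * p > 0"
    and k: "\<And>a b. {a, b} \<in> E \<Longrightarrow> \<bar>\<theta>\<^sub>0 a - \<theta>\<^sub>0 b\<bar> \<le> k"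
    and \<theta>\<^sub>0: "(\<Sum>i = 1..n. \<theta>\<^sub>0 i) = 0" and \<rho>: "\<rho> > 0"
    and exist: "\<And>t. 0 \<le> t \<Longrightarrow> t \<le> 1 \<Longrightarrow> \<exists>\<theta>. on_path n E \<rho> \<theta>\<^sub>0 h t \<theta>"
    and path: "on_path n E \<rho> \<theta>\<^sub>0 h 1 \<theta>"
    and H2: "L2_set h {1..n} \<le> H2" and Hinf: "\<And>i. i \<in> {1..n} \<Longrightarrow> \<bar>h i\<bar> \<le> Hinf"
  defines "m \<equiv> exp (- (k + 2)) / 4"
  defines "\<beta> \<equiv> 4 / (m * (real n * p)) * (sqrt (3 * (real n * p)) / 4 * (96 * H2 / (m * (real n * p))) + Hinf)"
  assumes small: "\<beta> \<le> 1 / 2"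
  shows "L2_set (\<lambda>i. \<theta> i - \<theta>\<^sub>0 i) {1..n} \<le> 96 * H2 / (m * (real n * p))"
    and "\<And>i. i \<in> {1..n} \<Longrightarrow> \<bar>\<theta> i - \<theta>\<^sub>0 i\<bar> \<le> \<beta>"
proof -
  have m: "m > 0" by (simp add: m_def)
  have local: "L2_set (\<lambda>i. \<theta> i - \<theta>\<^sub>0 i) {1..n} \<le> 96 * H2 / (m * (real n * p)) \<and> (\<forall>i\<in>{1..n}. \<bar>\<theta> i - \<theta>\<^sub>0 i\<bar> \<le> \<beta>)"
    if t: "0 \<le> t" "t \<le> 1" and path: "on_path n E \<rho> \<theta>\<^sub>0 h t \<theta>"
      and near: "\<And>i. i \<in> {1..n} \<Longrightarrow> \<bar>\<theta> i - \<theta>\<^sub>0 i\<bar> \<le> 1" for t \<theta>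
  proof -
    have "L2_set (\<lambda>i. \<theta> i - \<theta>\<^sub>0 i) {1..n} \<le> 96 * L2_set h {1..n} / (m * (real n * p))"
      unfolding m_def by (rule path_local_bound(1)[OF ex n np _ \<theta>\<^sub>0 less_imp_le[OF \<rho>] t path]) (use k near in auto)
    also have "\<dots> \<le> 96 * H2 / (m * (real n * p))" using H2 m np by (intro divide_right_mono) auto
    finally have l2: "L2_set (\<lambda>i. \<theta> i - \<theta>\<^sub>0 i) {1..n} \<le> 96 * H2 / (m * (real n * p))" .
    moreover have "\<bar>\<theta> i - \<theta>\<^sub>0 i\<bar> \<le> \<beta>" if i: "i \<in> {1..n}" for i
    proof -
      have "\<bar>\<theta> i - \<theta>\<^sub>0 i\<bar> \<le> 4 / (m * (real n * p)) * (sqrt (3 * (real n * p)) / 4 * L2_set (\<lambda>i. \<theta> i - \<theta>\<^sub>0 i) {1..n} + \<bar>h i\<bar>)"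
        unfolding m_def by (rule path_local_bound(2)[OF ex n np _ \<theta>\<^sub>0 less_imp_le[OF \<rho>] t path]) (use k near i in auto)
      also have "\<dots> \<le> \<beta>" unfolding \<beta>_def
        using m np by (intro mult_left_mono add_mono l2 Hinf[OF i]) auto
      finally show ?thesis .
    qed
    ultimately show ?thesis by blast
  qed
  define Lip where "Lip = L2_set h {1..n} / \<rho>"
  have Lip: "\<bar>\<theta> i - \<theta>' i\<bar> \<le> \<bar>s - t\<bar> * Lip"
    if "on_path n E \<rho> \<theta>\<^sub>0 h s \<theta>" "on_path n E \<rho> \<theta>\<^sub>0 h t \<theta>'" "i \<in> {1..n}" for s t \<theta> \<theta>' i
  proof -
    have "\<bar>\<theta> i - \<theta>' i\<bar> \<le> L2_set (\<lambda>i. \<theta> i - \<theta>' i) {1..n}"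
      using abs_le_L2_set[of "{1..n}" i "\<lambda>i. \<theta> i - \<theta>' i"] that by simp
    also have "\<dots> \<le> \<bar>s - t\<bar> * Lip"
      using path_lipschitz[OF that(1,2)] \<rho> by (simp add: Lip_def field_simps)
    finally show ?thesis .
  qed
  obtain M :: nat where M: "real M \<ge> 2 * Lip" "M > 0"
  proof -
    obtain M :: nat where "real M > max (2 * Lip) 0" using reals_Archimedean2 by blast
    thus ?thesis by (intro that[of M]) auto
  qed
  have step: "\<And>\<theta>. on_path n E \<rho> \<theta>\<^sub>0 h (real j / real M) \<theta> \<Longrightarrow> (\<forall>i\<in>{1..n}. \<bar>\<theta> i - \<theta>\<^sub>0 i\<bar> \<le> 1)" if "j \<le> M" for j
    using that
  proof (induction j)
    case 0
    have start: "on_path n E \<rho> \<theta>\<^sub>0 h 0 \<theta>\<^sub>0" using \<theta>\<^sub>0 by (simp add: on_path_def)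
    have "on_path n E \<rho> \<theta>\<^sub>0 h 0 \<theta>" using 0 by simp
    from Lip[OF this start] show ?case by simp
  next
    case (Suc j)
    have j1: "0 \<le> real j / real M" "real j / real M \<le> 1" using Suc.prems by auto
    obtain \<theta>' where \<theta>': "on_path n E \<rho> \<theta>\<^sub>0 h (real j / real M) \<theta>'" using exist[OF j1] by blast
    have near: "\<forall>i\<in>{1..n}. \<bar>\<theta>' i - \<theta>\<^sub>0 i\<bar> \<le> 1" using Suc.IH[OF \<theta>'] Suc.prems by simp
    have half: "\<bar>\<theta>' i - \<theta>\<^sub>0 i\<bar> \<le> 1 / 2" if "i \<in> {1..n}" for i
    proof -
      have "\<bar>\<theta>' i - \<theta>\<^sub>0 i\<bar> \<le> \<beta>" using local[OF j1 \<theta>'] near that by blast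
      thus ?thesis using small by linarith
    qed
    have "\<bar>\<theta> i - \<theta>' i\<bar> \<le> 1 / 2" if "i \<in> {1..n}" for i
    proof -
      have "\<bar>\<theta> i - \<theta>' i\<bar> \<le> \<bar>real (Suc j) / real M - real j / real M\<bar> * Lip"
        by (rule Lip[OF Suc.prems(1) \<theta>' that])
      also have "\<bar>real (Suc j) / real M - real j / real M\<bar> = 1 / real M"
        by (simp add: diff_divide_distrib[symmetric])
      also have "1 / real M * Lip \<le> 1 / 2" using M by (simp add: field_simps)
      finally show ?thesis .
    qed
    show ?case
    proof
      fix i assume "i \<in> {1..n}"
      from half[OF this] \<open>\<And>i. i \<in> {1..n} \<Longrightarrow> \<bar>\<theta> i - \<theta>' i\<bar> \<le> 1 / 2\<close>[OF this]
      show "\<bar>\<theta> i - \<theta>\<^sub>0 i\<bar> \<le> 1" by linarith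
    qed
  qed
  have "\<forall>i\<in>{1..n}. \<bar>\<theta> i - \<theta>\<^sub>0 i\<bar> \<le> 1" using step[of M \<theta>] path M by simp
  hence "L2_set (\<lambda>i. \<theta> i - \<theta>\<^sub>0 i) {1..n} \<le> 96 * H2 / (m * (real n * p)) \<and> (\<forall>i\<in>{1..n}. \<bar>\<theta> i - \<theta>\<^sub>0 i\<bar> \<le> \<beta>)"
    by (intro local[OF _ _ path]) auto
  thus "L2_set (\<lambda>i. \<theta> i - \<theta>\<^sub>0 i) {1..n} \<le> 96 * H2 / (m * (real n * p))"
    "\<And>i. i \<in> {1..n} \<Longrightarrow> \<bar>\<theta> i - \<theta>\<^sub>0 i\<bar> \<le> \<beta>" by auto
qed

section \<open>The estimation error\<close>

text \<open>
  The choice operator in \<open>arg_min\<close> yields a minimiser as soon as one exists.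
\<close>
lemma reg_mle_minimises:
  assumes ex: "\<exists>\<theta>\<in>centred n. \<forall>\<theta>'\<in>centred n. reg_loss n E (ybar L y) (\<lambda>_. 0) \<rho> \<theta> \<le> reg_loss n E (ybar L y) (\<lambda>_. 0) \<rho> \<theta>'"
  shows "reg_mle n L \<rho> E y \<in> centred n"
    and "\<And>\<theta>. \<theta> \<in> centred n \<Longrightarrow>
           reg_loss n E (ybar L y) (\<lambda>_. 0) \<rho> (reg_mle n L \<rho> E y) \<le> reg_loss n E (ybar L y) (\<lambda>_. 0) \<rho> \<theta>"
proof -
  let ?f = "reg_loss n E (ybar L y) (\<lambda>_. 0) \<rho>"
  have f: "(\<lambda>\<theta>. neg_log_lik n L E y \<theta> + \<rho> / 2 * (L2_set \<theta> {1..n})\<^sup>2) = ?f"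
    by (simp add: fun_eq_iff neg_log_lik_def reg_loss_def pairs_def L2_set_square)
  have P: "(\<lambda>\<theta>. \<theta> \<in> {1..n} \<rightarrow>\<^sub>E UNIV \<and> (\<Sum>i = 1..n. \<theta> i) = 0) = (\<lambda>\<theta>. \<theta> \<in> centred n)"
    by (simp add: fun_eq_iff centred_def)
  have "\<exists>\<theta>. is_arg_min ?f (\<lambda>\<theta>. \<theta> \<in> centred n) \<theta>"
    using ex by (auto simp: is_arg_min_def not_less)
  hence "is_arg_min ?f (\<lambda>\<theta>. \<theta> \<in> centred n) (reg_mle n L \<rho> E y)"
    unfolding reg_mle_def f P arg_min_def by (rule someI_ex)
  thus "reg_mle n L \<rho> E y \<in> centred n"
    "\<And>\<theta>. \<theta> \<in> centred n \<Longrightarrow> ?f (reg_mle n L \<rho> E y) \<le> ?f \<theta>"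
    by (auto simp: is_arg_min_def not_less)
qed

lemma ybar_bounds: "0 \<le> ybar L y i j \<and> ybar L y i j \<le> 1"
proof -
  have "(\<Sum>l = 1..L. of_bool (y (i, j, l))) \<le> (\<Sum>l = 1..L. 1 :: real)" by (intro sum_mono) auto
  thus ?thesis unfolding ybar_def by (cases "L = 0") (auto intro!: divide_nonneg_nonneg sum_nonneg simp: divide_le_eq_1)
qed

lemma card_neighbours: "real (card {j \<in> {1..n}. {i, j} \<in> E}) = (\<Sum>b = 1..n. adj E i b)"
  by (simp add: adj_def Int_def)

lemma degree_le_max_degree:
  assumes "i \<in> {1..n}"
  shows "(\<Sum>b = 1..n. adj E i b) \<le> real (max_degree n E)"
proof -
  have "card {j \<in> {1..n}. {i, j} \<in> E} \<le> max_degree n E"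
    unfolding max_degree_def by (intro Max_ge) (use assms in auto)
  thus ?thesis unfolding card_neighbours[symmetric] by simp
qed

lemma max_degree_le:
  assumes "n \<ge> 1" and deg: "\<And>i. i \<in> {1..n} \<Longrightarrow> (\<Sum>b = 1..n. adj E i b) \<le> D"
  shows "real (max_degree n E) \<le> D"
proof -
  have "max_degree n E \<in> (\<lambda>i. card {j \<in> {1..n}. {i, j} \<in> E}) ` {1..n}"
    unfolding max_degree_def using assms(1) by (intro Max_in) auto
  then obtain i where "i \<in> {1..n}" "max_degree n E = card {j \<in> {1..n}. {i, j} \<in> E}" by auto
  thus ?thesis using deg[of i] by (simp only: card_neighbours)
qed

text \<open>
  A coordinate of a centred vector is the average of its differences to all coordinates.
\<close>
lemma abs_le_kappa:
  assumes i: "i \<in> {1..n}" and sum0: "(\<Sum>i = 1..n. \<theta> i) = 0"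
  shows "\<bar>\<theta> i\<bar> \<le> kappa n \<theta>"
proof -
  have le: "\<bar>\<theta> i - \<theta> j\<bar> \<le> kappa n \<theta>" if "j \<in> {1..n}" for j
  proof -
    have "finite {\<bar>\<theta> i - \<theta> j\<bar> | i j. i \<in> {1..n} \<and> j \<in> {1..n}}"
      by (intro finite_image_set2) auto
    thus ?thesis unfolding kappa_def using i that by (intro Max_ge) auto
  qed
  have "real n * \<theta> i = (\<Sum>j = 1..n. \<theta> i - \<theta> j)" using sum0 by (simp add: sum_subtractf)
  hence "real n * \<bar>\<theta> i\<bar> = \<bar>\<Sum>j = 1..n. \<theta> i - \<theta> j\<bar>" by (metis abs_mult abs_of_nat)
  also have "\<dots> \<le> (\<Sum>j = 1..n. kappa n \<theta>)" by (rule order_trans[OF sum_abs]) (intro sum_mono le)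
  finally show ?thesis using i by simp
qed

lemma finite_edge_differences:
  assumes "E \<subseteq> vertex_pairs n"
  shows "finite {\<bar>\<theta> i - \<theta> j :: real\<bar> | i j. {i, j} \<in> E}"
proof (rule finite_subset)
  show "{\<bar>\<theta> i - \<theta> j\<bar> | i j. {i, j} \<in> E} \<subseteq> {\<bar>\<theta> i - \<theta> j\<bar> | i j. i \<in> {1..n} \<and> j \<in> {1..n}}"
    using assms by (fastforce simp: vertex_pairs_def)
  show "finite {\<bar>\<theta> i - \<theta> j\<bar> | i j. i \<in> {1..n} \<and> j \<in> {1..n}}"
    by (intro finite_image_set2) auto
qed

lemma abs_diff_le_kappa_E:
  assumes E: "E \<subseteq> vertex_pairs n" and ij: "{i, j} \<in> E"
  shows "\<bar>\<theta> i - \<theta> j\<bar> \<le> kappa_E E \<theta>"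
  unfolding kappa_E_def using finite_edge_differences[OF E] ij by (intro Max_ge) auto

lemma kappa_E_nonneg:
  assumes E: "E \<subseteq> vertex_pairs n"
  shows "kappa_E E \<theta> \<ge> 0"
  unfolding kappa_E_def using finite_edge_differences[OF E] by (intro Max_ge) auto

text \<open>
  For a graph with an edge \<open>\<rho>\<close> is positive and a minimiser exists by compactness. For the empty
  graph \<open>\<rho> = 0\<close> and the objective is constantly zero.
\<close>
lemma reg_mle_sum_zero:
  assumes c: "c_rho > 0" and \<kappa>: "kappa n \<theta> > 0" and L: "1 \<le> L"
  shows "(\<Sum>i = 1..n. reg_mle n L (rho c_rho n L \<theta> E) E y i) = 0"
proof -
  have "\<exists>\<theta>'\<in>centred n. \<forall>\<theta>''\<in>centred n. reg_loss n E (ybar L y) (\<lambda>_. 0) (rho c_rho n L \<theta> E) \<theta>'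
       \<le> reg_loss n E (ybar L y) (\<lambda>_. 0) (rho c_rho n L \<theta> E) \<theta>''"
  proof (cases "max_degree n E = 0")
    case False
    hence "rho c_rho n L \<theta> E > 0" using c \<kappa> L by (simp add: rho_def)
    thus ?thesis by (intro reg_loss_minimiser_exists ybar_bounds)
  next
    case True
    have deg: "(\<Sum>b = 1..n. adj E i b) \<le> 0" if "i \<in> {1..n}" for i
      using degree_le_max_degree[OF that, of E] True by simp
    have adj0: "adj E i j = 0" if "(i, j) \<in> pairs n" for i j
    proof -
      have ij: "i \<in> {1..n}" "j \<in> {1..n}" using that by (auto simp: pairs_def)
      have "adj E i j \<le> (\<Sum>b = 1..n. adj E i b)" using ij by (intro member_le_sum) (auto simp: adj_def)
      hence "adj E i j \<le> 0" using deg[OF ij(1)] by linarith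
      thus ?thesis by (cases "{i, j} \<in> E") (auto simp: adj_def)
    qed
    have lik0: "(\<Sum>(i, j)\<in>pairs n. adj E i j * g i j) = 0" for g
      using adj0 by (intro sum.neutral) auto
    have "rho c_rho n L \<theta> E = 0" using True by (simp add: rho_def)
    hence "reg_loss n E (ybar L y) (\<lambda>_. 0) (rho c_rho n L \<theta> E) \<theta>' = 0" for \<theta>'
      by (simp add: reg_loss_def lik0)
    moreover have "(\<lambda>i. if i \<in> {1..n} then 0 else undefined) \<in> centred n" by (auto simp: centred_def)
    ultimately show ?thesis by auto
  qed
  from reg_mle_minimises(1)[OF this] show ?thesis by (simp add: centred_def)
qed

lemma ln_le_sqrt:
  assumes "x > 0"
  shows "ln x \<le> sqrt (x::real)"
proof -
  have "ln (sqrt x) \<le> sqrt x / exp 1"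
  proof -
    have "ln (sqrt x / exp 1) \<le> sqrt x / exp 1 - 1" using assms by (intro ln_le_minus_one) auto
    thus ?thesis using assms by (simp add: ln_div)
  qed
  also have "sqrt x / exp 1 \<le> sqrt x / 2"
    using assms exp_ge_add_one_self[of "1::real"] by (intro divide_left_mono) auto
  finally show ?thesis using assms by (simp add: ln_sqrt)
qed

lemma ln_ge_half: "n \<ge> 2 \<Longrightarrow> ln (real n) \<ge> 1 / 2"
  using ln2_ge_two_thirds ln_mono[of 2 "real n"] by linarith

text \<open>
  The path argument on the good event, with explicit constants. The weights have a lower bound \<open>m\<close>
  with \<open>1 / m = 4 exp (\<kappa>\<^sub>E + 2) \<le> 36 exp \<kappa>\<^sub>E\<close>. The lower bound on \<open>L\<close> makes both terms of the
  maximum-norm bound so small that the distance \<open>\<beta>\<close> in the path argument is at most \<open>1 / 2\<close>.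
\<close>
lemma reg_mle_error_bound:
  assumes c: "c_rho > 0" and n: "2 \<le> n" and L: "1 \<le> L" and \<theta>: "(\<Sum>i = 1..n. \<theta> i) = 0" and \<kappa>: "kappa n \<theta> > 0"
    and p: "0 \<le> p" and np: "real n * p > 120 * ln (real n)" and ex: "expanding n p E"
    and score_inf: "\<And>i. i \<in> {1..n} \<Longrightarrow> \<bar>score n E (ybar L y) \<theta> i\<bar> \<le> sqrt (5 * (3 * (real n * p)) * ln (real n) / real L)"
    and score_2: "(\<Sum>i = 1..n. (score n E (ybar L y) \<theta> i)\<^sup>2) \<le> 4 * real n * (3 * (real n * p)) / real L"
    and L_large: "real L \<ge> 16 * (10 ^ 6 * (1 + c_rho))\<^sup>2 * max 1 (kappa n \<theta>) * exp (4 * kappa_E E \<theta>) * real n / (ln (real n))\<^sup>2"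
  defines "\<theta>' \<equiv> reg_mle n L (rho c_rho n L \<theta> E) E y"
  shows "Linf_norm n (\<lambda>i. \<theta>' i - \<theta> i)
             \<le> 10 ^ 6 * (1 + c_rho) * (exp (2 * kappa_E E \<theta>) * sqrt (1 / (real n * p\<^sup>2 * real L))
                        + exp (kappa_E E \<theta>) * sqrt (ln (real n) / (real n * p * real L)))"
    and "L2_set (\<lambda>i. \<theta>' i - \<theta> i) {1..n} \<le> 13824 * (1 + c_rho) * (exp (kappa_E E \<theta>) * sqrt (1 / (p * real L)))"
proof -
  define a where "a = 1 + c_rho"
  define q where "q = real n * p"
  define k where "k = kappa_E E \<theta>"
  define r where "r = rho c_rho n L \<theta> E"
  define l where "l = ln (real n)"
  have a: "a > 1" using c by (simp add: a_def)
  have l: "l \<ge> 1 / 2" using ln_ge_half[OF n] by (simp add: l_def)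
  have q: "q > 0" "q \<ge> l" using np l by (auto simp: q_def l_def)
  have L0: "real L > 0" using L by simp
  have p0: "p > 0" using q p by (cases "p = 0") (auto simp: q_def)
  have n0: "real n > 0" using n by simp
  have k0: "k \<ge> 0" unfolding k_def by (rule kappa_E_nonneg[OF expandingD(1)[OF ex]])
  define D where "D = real (max_degree n E)"
  have D: "D \<le> 3 * q" unfolding D_def q_def
    by (rule max_degree_le) (use n expandingD(3)[OF ex] in auto)
  have "q / 4 \<le> (\<Sum>b = 1..n. adj E 1 b)" unfolding q_def
    using expanding_degree_lower[OF ex n, of 1] n by simp
  also have "\<dots> \<le> D" unfolding D_def by (rule degree_le_max_degree) (use n in auto)
  finally have D0: "D > 0" using q by linarith
  have r: "r = c_rho / kappa n \<theta> * sqrt (D / real L)" by (simp add: r_def rho_def D_def)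
  have r0: "r > 0" using c \<kappa> D0 L0 by (simp add: r)
  define h where "h i = score n E (ybar L y) \<theta> i + r * \<theta> i" for i
  define H2 where "H2 = 4 * a * sqrt (real n * q / real L)"
  define Hinf where "Hinf = 4 * a * sqrt (q * l / real L)"
  have reg: "\<bar>r * \<theta> i\<bar> \<le> c_rho * sqrt (3 * q / real L)" if "i \<in> {1..n}" for i
  proof -
    have "\<bar>r * \<theta> i\<bar> = r * \<bar>\<theta> i\<bar>" using r0 by (simp add: abs_mult)
    also have "\<dots> \<le> r * kappa n \<theta>" using r0 abs_le_kappa[OF that \<theta>] by (intro mult_left_mono) auto
    also have "\<dots> = c_rho * sqrt (D / real L)" using \<kappa> by (simp add: r)
    also have "\<dots> \<le> c_rho * sqrt (3 * q / real L)"
      using c D L0 by (intro mult_left_mono real_sqrt_le_mono divide_right_mono) auto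
    finally show ?thesis .
  qed
  have Hinf: "\<bar>h i\<bar> \<le> Hinf" if i: "i \<in> {1..n}" for i
  proof -
    have "sqrt (5 * (3 * q) * l / real L) \<le> sqrt (4\<^sup>2 * (q * l / real L))"
      using q l L0 by (intro real_sqrt_le_mono) (simp add: divide_right_mono)
    also have "\<dots> = 4 * sqrt (q * l / real L)" by (simp only: real_sqrt_mult real_sqrt_power) simp
    finally have "\<bar>score n E (ybar L y) \<theta> i\<bar> \<le> 4 * sqrt (q * l / real L)"
      using score_inf[OF i] unfolding q_def l_def by linarith
    moreover have "c_rho * sqrt (3 * q / real L) \<le> c_rho * (4 * sqrt (q * l / real L))"
    proof (intro mult_left_mono)
      have "sqrt (3 * q / real L) \<le> sqrt (4\<^sup>2 * (q * l / real L))"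
        using q l L0 by (intro real_sqrt_le_mono) (simp add: divide_right_mono)
      also have "\<dots> = 4 * sqrt (q * l / real L)" by (simp only: real_sqrt_mult real_sqrt_power) simp
      finally show "sqrt (3 * q / real L) \<le> 4 * sqrt (q * l / real L)" .
    qed (use c in auto)
    ultimately show ?thesis using reg[OF i] abs_triangle_ineq[of "score n E (ybar L y) \<theta> i" "r * \<theta> i"]
      by (simp add: h_def Hinf_def a_def algebra_simps)
  qed
  have H2: "L2_set h {1..n} \<le> H2"
  proof -
    have "L2_set h {1..n} \<le> L2_set (score n E (ybar L y) \<theta>) {1..n} + L2_set (\<lambda>i. r * \<theta> i) {1..n}"
      unfolding h_def by (rule L2_set_triangle_ineq)
    also have "L2_set (score n E (ybar L y) \<theta>) {1..n} \<le> 4 * sqrt (real n * q / real L)"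
    proof -
      have "L2_set (score n E (ybar L y) \<theta>) {1..n} \<le> sqrt (4 * real n * (3 * q) / real L)"
        unfolding L2_set_def q_def by (intro real_sqrt_le_mono score_2)
      also have "\<dots> \<le> sqrt (4\<^sup>2 * (real n * q / real L))"
        using q n0 L0 by (intro real_sqrt_le_mono) (simp add: divide_right_mono)
      also have "\<dots> = 4 * sqrt (real n * q / real L)" by (simp only: real_sqrt_mult real_sqrt_power) simp
      finally show ?thesis .
    qed
    also have "L2_set (\<lambda>i. r * \<theta> i) {1..n} \<le> c_rho * (4 * sqrt (real n * q / real L))"
    proof -
      have "L2_set (\<lambda>i. r * \<theta> i) {1..n} \<le> sqrt (\<Sum>i = 1..n. (c_rho * sqrt (3 * q / real L))\<^sup>2)"
        unfolding L2_set_def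
      proof (intro real_sqrt_le_mono sum_mono)
        fix i assume "i \<in> {1..n}"
        from power_mono[OF reg[OF this], of 2] show "(r * \<theta> i)\<^sup>2 \<le> (c_rho * sqrt (3 * q / real L))\<^sup>2" by simp
      qed
      also have "\<dots> = sqrt (c_rho\<^sup>2 * (3 * (real n * q / real L)))"
        using q L0 by (simp add: power_mult_distrib)
      also have "\<dots> \<le> sqrt (c_rho\<^sup>2 * (4\<^sup>2 * (real n * q / real L)))"
        using q n0 L0 by (intro real_sqrt_le_mono mult_left_mono mult_right_mono) auto
      also have "\<dots> = c_rho * (4 * sqrt (real n * q / real L))"
        using c by (simp only: real_sqrt_mult real_sqrt_power) simp
      finally show ?thesis .
    qed
    finally show ?thesis by (simp add: H2_def a_def algebra_simps)
  qed
  define m where "m = exp (- (k + 2)) / (4 :: real)"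
  have m: "m > 0" "1 / m \<le> 36 * exp k"
  proof -
    have "exp 2 = exp (1::real) ^ 2" by (simp add: exp_of_nat_mult[symmetric])
    also have "\<dots> \<le> 3 ^ 2" using exp_le by (intro power_mono) auto
    finally have "exp 2 \<le> (9::real)" by simp
    hence "exp k * exp 2 \<le> exp k * 9" by (intro mult_left_mono) auto
    moreover have "1 / m = 4 * (exp k * exp 2)"
    proof -
      have "exp (- (k + 2)) = inverse (exp k * exp 2)" unfolding exp_minus exp_add by (rule refl)
      thus ?thesis unfolding m_def by (simp add: field_simps del: minus_add_distrib)
    qed
    ultimately show "1 / m \<le> 36 * exp k" by simp
  qed (simp add: m_def)
  define T1 where "T1 = exp (2 * k) * sqrt (1 / (real n * p\<^sup>2 * real L))"
  define T2 where "T2 = exp k * sqrt (l / (real n * p * real L))"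
  define \<beta> where "\<beta> = 4 / (m * q) * (sqrt (3 * q) / 4 * (96 * H2 / (m * q)) + Hinf)"
  have sqrt_div: "sqrt x / q = sqrt (x / q\<^sup>2)" for x
    using q by (simp add: real_sqrt_divide)
  have L2b: "96 * H2 / (m * q) \<le> 13824 * a * (exp k * sqrt (1 / (p * real L)))"
  proof -
    have "sqrt (real n * q / real L) / q = sqrt (real n * q / real L / q\<^sup>2)"
      by (rule sqrt_div)
    also have "real n * q / real L / q\<^sup>2 = 1 / (p * real L)"
      using n0 p0 L0 by (simp add: q_def power2_eq_square)
    finally have e: "sqrt (real n * q / real L) / q = sqrt (1 / (p * real L))" .
    have "96 * H2 / (m * q) = 384 * a * (sqrt (real n * q / real L) / q) * (1 / m)"
      by (simp add: H2_def mult_ac)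
    also have "\<dots> = 384 * a * sqrt (1 / (p * real L)) * (1 / m)" by (simp only: e)
    also have "\<dots> \<le> 384 * a * sqrt (1 / (p * real L)) * (36 * exp k)"
      using a m p0 L0 by (intro mult_left_mono) auto
    finally show ?thesis by (simp add: mult_ac)
  qed
  have \<beta>: "\<beta> \<le> 10 ^ 6 * a * (T1 + T2)"
  proof -
    have first: "4 / (m * q) * (sqrt (3 * q) / 4 * (96 * H2 / (m * q))) \<le> 10 ^ 6 * a * T1"
    proof -
      have "sqrt (3 * q) / q * sqrt (1 / (p * real L)) = sqrt 3 * sqrt (1 / (real n * p\<^sup>2 * real L))"
      proof -
        have "sqrt (3 * q) / q * sqrt (1 / (p * real L)) = sqrt (3 * q / q\<^sup>2 * (1 / (p * real L)))"
          unfolding sqrt_div by (rule real_sqrt_mult[symmetric])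
        also have "3 * q / q\<^sup>2 * (1 / (p * real L)) = 3 * (1 / (real n * p\<^sup>2 * real L))"
          using n0 p0 L0 by (simp add: q_def power2_eq_square)
        finally show ?thesis by (simp only: real_sqrt_mult)
      qed
      note e = this
      have "4 / (m * q) * (sqrt (3 * q) / 4 * (96 * H2 / (m * q)))
         \<le> 4 / (m * q) * (sqrt (3 * q) / 4 * (13824 * a * (exp k * sqrt (1 / (p * real L)))))"
        using m q by (intro mult_left_mono L2b) auto
      also have "\<dots> = 13824 * a * exp k * (sqrt (3 * q) / q * sqrt (1 / (p * real L))) * (1 / m)"
      proof -
        have "4 / (m * q) * (s / 4 * (x * (y * z))) = x * y * (s / q * z) * (1 / m)" for s x y z :: real
          by (simp add: mult_ac)
        thus ?thesis by blast
      qed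
      also have "\<dots> \<le> 13824 * a * exp k * (sqrt 3 * sqrt (1 / (real n * p\<^sup>2 * real L))) * (36 * exp k)"
        unfolding e using m a n0 L0 by (intro mult_left_mono) auto
      also have "\<dots> = 13824 * 36 * sqrt 3 * (a * T1)"
      proof -
        have "exp (2 * k) = exp k * exp k" by (simp only: mult_2 exp_add)
        thus ?thesis by (simp add: T1_def mult_ac)
      qed
      also have "\<dots> \<le> 10 ^ 6 * (a * T1)"
      proof (intro mult_right_mono)
        have "sqrt 3 \<le> (2::real)" by (rule real_le_lsqrt) auto
        thus "13824 * 36 * sqrt 3 \<le> (10 ^ 6 :: real)" by simp
        show "0 \<le> a * T1" using a n0 L0 by (simp add: T1_def)
      qed
      finally show ?thesis by (simp add: mult_ac)
    qed
    have second: "4 / (m * q) * Hinf \<le> 10 ^ 6 * a * T2"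
    proof -
      have "sqrt (q * l / real L) / q = sqrt (q * l / real L / q\<^sup>2)"
        by (rule sqrt_div)
      also have "q * l / real L / q\<^sup>2 = l / (real n * p * real L)"
        using n0 p0 L0 by (simp add: q_def power2_eq_square)
      finally have e: "sqrt (q * l / real L) / q = sqrt (l / (real n * p * real L))" .
      have "4 / (m * q) * Hinf = 16 * a * (sqrt (q * l / real L) / q) * (1 / m)"
        by (simp add: Hinf_def mult_ac)
      also have "\<dots> = 16 * a * sqrt (l / (real n * p * real L)) * (1 / m)" by (simp only: e)
      also have "\<dots> \<le> 16 * a * sqrt (l / (real n * p * real L)) * (36 * exp k)"
        using a m p0 L0 n0 l by (intro mult_left_mono) auto
      also have "\<dots> = 576 * (a * T2)" by (simp add: T2_def mult_ac)
      also have "\<dots> \<le> 10 ^ 6 * (a * T2)"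
        using a l n0 L0 p0 by (intro mult_right_mono) (auto simp: T2_def)
      finally show ?thesis by (simp add: mult_ac)
    qed
    show ?thesis unfolding \<beta>_def using first second by (simp only: distrib_left)
  qed
  define C where "C = 16 * (10 ^ 6 * a)\<^sup>2"
  have C: "C > 0" using a by (simp add: C_def)
  have frac: "u / v \<le> 1 / C" if "C * u \<le> v" "v > 0" for u v
    using that C by (simp add: field_simps)
  have LC: "C * exp (4 * k) * real n \<le> real L * l\<^sup>2"
  proof -
    have "C * 1 * exp (4 * k) * real n / l\<^sup>2 \<le> C * max 1 (kappa n \<theta>) * exp (4 * k) * real n / l\<^sup>2"
      using C by (intro divide_right_mono mult_right_mono mult_left_mono) auto
    also have "\<dots> \<le> real L" using L_large by (simp add: C_def a_def k_def l_def)
    finally have "C * exp (4 * k) * real n / l\<^sup>2 \<le> real L" by simp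
    thus ?thesis using l by (simp add: pos_divide_le_eq)
  qed
  have sqC: "sqrt (1 / C) = 1 / (4 * (10 ^ 6 * a))"
    unfolding C_def using a by (simp add: real_sqrt_divide real_sqrt_mult)
  \<comment> \<open>The two terms \<open>T1\<close> and \<open>T2\<close> of the bound are at most \<open>sqrt (1 / C)\<close>: the first because \<open>n p \<ge> log n\<close>,
    the second also because \<open>log n \<le> sqrt n\<close>.\<close>
  have "T1 \<le> sqrt (1 / C)"
  proof (rule real_le_rsqrt)
    have "T1\<^sup>2 = exp (4 * k) / (real n * p\<^sup>2 * real L)"
      using n0 L0 by (simp add: T1_def power_mult_distrib exp_of_nat_mult[symmetric])
    also have "\<dots> \<le> 1 / C"
    proof -
      have "C * exp (4 * k) * real n \<le> real L * q\<^sup>2"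
      proof -
        have "l\<^sup>2 \<le> q\<^sup>2" using q l by (intro power_mono) auto
        hence "real L * l\<^sup>2 \<le> real L * q\<^sup>2" by (intro mult_left_mono) auto
        thus ?thesis using LC by linarith
      qed
      also have "\<dots> = real n * p\<^sup>2 * real L * real n" by (simp add: q_def power2_eq_square)
      finally have "C * exp (4 * k) \<le> real n * p\<^sup>2 * real L" using n0 by (simp add: mult_ac)
      thus ?thesis using n0 p0 L0 by (intro frac) auto
    qed
    finally show "T1\<^sup>2 \<le> 1 / C" .
  qed
  moreover have "T2 \<le> sqrt (1 / C)"
  proof (rule real_le_rsqrt)
    have "T2\<^sup>2 = exp (2 * k) * l / (q * real L)"
      using n0 L0 p0 l by (simp add: T2_def q_def power_mult_distrib exp_of_nat_mult[symmetric])
    also have "\<dots> \<le> 1 / C"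
    proof -
      have "l \<le> sqrt (real n)" unfolding l_def by (rule ln_le_sqrt) (use n0 in auto)
      hence "l\<^sup>2 \<le> (sqrt (real n))\<^sup>2" using l by (intro power_mono) auto
      hence "real L * l\<^sup>2 \<le> real L * real n" by (intro mult_left_mono) auto
      hence "C * exp (4 * k) * real n \<le> real L * real n" using LC by linarith
      hence "C * exp (4 * k) \<le> real L" by (rule mult_right_le_imp_le) (rule n0)
      moreover have "C * exp (2 * k) \<le> C * exp (4 * k)" using C k0 by (intro mult_left_mono) auto
      ultimately have "C * exp (2 * k) \<le> real L" by linarith
      hence "C * exp (2 * k) * l \<le> real L * q" using q l L0 C by (intro mult_mono) auto
      thus ?thesis using q L0 by (intro frac) (auto simp: mult_ac)
    qed
    finally show "T2\<^sup>2 \<le> 1 / C" .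
  qed
  ultimately have "10 ^ 6 * a * (T1 + T2) \<le> 10 ^ 6 * a * (2 * sqrt (1 / C))"
    using a by (intro mult_left_mono) auto
  also have "\<dots> = 1 / 2" unfolding sqC using a by simp
  finally have small: "\<beta> \<le> 1 / 2" using \<beta> by linarith
  have exist: "\<exists>\<theta>''. on_path n E r \<theta> h t \<theta>''" if "0 \<le> t" "t \<le> 1" for t
    unfolding h_def by (rule path_exists[OF r0 ybar_bounds \<theta> that])
  have path: "on_path n E r \<theta> h 1 \<theta>'"
  proof -
    show ?thesis unfolding h_def \<theta>'_def r_def[symmetric]
      by (rule minimiser_on_path[OF _ _ \<theta>]) (use reg_mle_minimises[OF reg_loss_minimiser_exists[OF r0 ybar_bounds]] in simp_all)
  qed
  have kE: "\<bar>\<theta> i - \<theta> j\<bar> \<le> k" if "{i, j} \<in> E" for i j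
    unfolding k_def by (rule abs_diff_le_kappa_E[OF expandingD(1)[OF ex] that])
  have "L2_set (\<lambda>i. \<theta>' i - \<theta> i) {1..n} \<le> 96 * H2 / (m * q)"
    using path_endpoint_bound(1)[OF ex n _ kE \<theta> r0 exist path H2 Hinf] small q
    unfolding q_def m_def \<beta>_def by blast
  thus "L2_set (\<lambda>i. \<theta>' i - \<theta> i) {1..n} \<le> 13824 * (1 + c_rho) * (exp (kappa_E E \<theta>) * sqrt (1 / (p * real L)))"
    using L2b unfolding a_def k_def by linarith
  have "\<bar>\<theta>' i - \<theta> i\<bar> \<le> 10 ^ 6 * a * (T1 + T2)" if "i \<in> {1..n}" for i
  proof -
    have "\<bar>\<theta>' i - \<theta> i\<bar> \<le> \<beta>"
      using path_endpoint_bound(2)[OF ex n _ kE \<theta> r0 exist path H2 Hinf _ that] small q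
      unfolding q_def m_def \<beta>_def by blast
    thus ?thesis using \<beta> by linarith
  qed
  hence "Linf_norm n (\<lambda>i. \<theta>' i - \<theta> i) \<le> 10 ^ 6 * a * (T1 + T2)"
    unfolding Linf_norm_def using n by (intro Max.boundedI) auto
  thus "Linf_norm n (\<lambda>i. \<theta>' i - \<theta> i)
             \<le> 10 ^ 6 * (1 + c_rho) * (exp (2 * kappa_E E \<theta>) * sqrt (1 / (real n * p\<^sup>2 * real L))
                        + exp (kappa_E E \<theta>) * sqrt (ln (real n) / (real n * p * real L)))"
    by (simp only: a_def T1_def T2_def k_def l_def)
qed

text \<open>
  A union bound for a two-stage experiment: the first stage fails, or the second fails given a good
  first stage.
\<close>
lemma prob_bind_pmf_le:
  assumes "\<And>x. x \<in> set_pmf q \<Longrightarrow> x \<notin> A \<Longrightarrow> measure_pmf.prob (f x) B \<le> \<delta>" and \<delta>: "\<delta> \<ge> 0"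
  shows "measure_pmf.prob (bind_pmf q f) B \<le> measure_pmf.prob q A + \<delta>"
proof -
  have "emeasure (measure_pmf (bind_pmf q f)) B = (\<integral>\<^sup>+ x. emeasure (measure_pmf (f x)) B \<partial>measure_pmf q)"
    by simp
  also have "\<dots> \<le> (\<integral>\<^sup>+ x. indicator A x + ennreal \<delta> \<partial>measure_pmf q)"
  proof (intro nn_integral_mono_AE AE_pmfI)
    fix x assume x: "x \<in> set_pmf q"
    show "emeasure (measure_pmf (f x)) B \<le> indicator A x + ennreal \<delta>"
    proof (cases "x \<in> A")
      case True
      have "emeasure (measure_pmf (f x)) B \<le> 1 + 0" by (simp add: measure_pmf.emeasure_le_1)
      also have "\<dots> \<le> 1 + ennreal \<delta>" by (intro add_left_mono) simp
      finally show ?thesis using True by simp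
    next
      case False
      thus ?thesis using assms(1)[OF x] by (simp add: measure_pmf.emeasure_eq_measure ennreal_leI)
    qed
  qed
  also have "\<dots> = emeasure (measure_pmf q) A + ennreal \<delta>"
    by (subst nn_integral_add) (auto simp: measure_pmf.emeasure_space_1)
  also have "\<dots> = ennreal (measure_pmf.prob q A + \<delta>)"
    using \<delta> by (simp add: measure_pmf.emeasure_eq_measure ennreal_plus)
  finally have "ennreal (measure_pmf.prob (bind_pmf q f) B) \<le> ennreal (measure_pmf.prob q A + \<delta>)"
    unfolding measure_pmf.emeasure_eq_measure .
  thus ?thesis using \<delta> by (subst (asm) ennreal_le_iff) auto
qed

theorem corollary2:
  fixes c_rho :: real
  assumes "c_rho > 0"
  shows "\<exists>C1>0. \<exists>C2>0. \<exists>K>0. \<exists>K_inf>0. \<exists>K_2>0.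
    \<forall>(n::nat) (p::real) (L::nat) (\<theta> :: nat \<Rightarrow> real).
      2 \<le> n \<longrightarrow> 0 \<le> p \<longrightarrow> p \<le> 1 \<longrightarrow> 1 \<le> L \<longrightarrow>
      (\<Sum>i = 1..n. \<theta> i) = 0 \<longrightarrow>
      0 < kappa n \<theta> \<longrightarrow> kappa n \<theta> \<le> real n \<longrightarrow>
      real n * p > C1 * ln (real n) \<longrightarrow>
      (\<forall>(E, y) \<in> set_pmf (btl_data n p L \<theta>).
         (\<Sum>i = 1..n. reg_mle n L (rho c_rho n L \<theta> E) E y i) = 0) \<and>
      measure_pmf.prob (btl_data n p L \<theta>)
        {(E, y).
           kappa_E E \<theta> \<le> ln (real n) \<and>
           real L \<le> real n ^ 8 * exp (4 * kappa_E E \<theta>) * max 1 (kappa n \<theta>) \<and>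
           real L \<ge> C2 * max 1 (kappa n \<theta>) * exp (4 * kappa_E E \<theta>) * real n / (ln (real n))\<^sup>2
           \<longrightarrow>
           Linf_norm n (\<lambda>i. reg_mle n L (rho c_rho n L \<theta> E) E y i - \<theta> i)
             \<le> K_inf * (exp (2 * kappa_E E \<theta>) * sqrt (1 / (real n * p\<^sup>2 * real L))
                        + exp (kappa_E E \<theta>) * sqrt (ln (real n) / (real n * p * real L))) \<and>
           L2_set (\<lambda>i. reg_mle n L (rho c_rho n L \<theta> E) E y i - \<theta> i) {1..n}
             \<le> K_2 * (exp (kappa_E E \<theta>) * sqrt (1 / (p * real L)))}
        \<ge> 1 - K / real n ^ 4"
\<comment> \<open>The probability \<open>261 / n ^ 4\<close> is \<open>3 / n ^ 4\<close> for the graph plus \<open>258 / n ^ 4\<close> for the noise.\<close>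
proof (rule exI[of _ 120], rule conjI, simp, rule exI[of _ "16 * (10 ^ 6 * (1 + c_rho))\<^sup>2"], rule conjI,
    use assms in simp, rule exI[of _ 261], rule conjI, simp, rule exI[of _ "10 ^ 6 * (1 + c_rho)"], rule conjI,
    use assms in simp, rule exI[of _ "13824 * (1 + c_rho)"], rule conjI, use assms in simp,
    intro allI impI, rule conjI)
  fix n :: nat and p :: real and L :: nat and \<theta> :: "nat \<Rightarrow> real"
  assume n: "2 \<le> n" and p: "0 \<le> p" "p \<le> 1" and L: "1 \<le> L" and \<theta>: "(\<Sum>i = 1..n. \<theta> i) = 0"
    and \<kappa>: "0 < kappa n \<theta>" and np: "real n * p > 120 * ln (real n)"
  show "\<forall>(E, y) \<in> set_pmf (btl_data n p L \<theta>). (\<Sum>i = 1..n. reg_mle n L (rho c_rho n L \<theta> E) E y i) = 0"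
    using reg_mle_sum_zero[OF assms \<kappa> L] by blast
  let ?T = "{(E, y).
           kappa_E E \<theta> \<le> ln (real n) \<and>
           real L \<le> real n ^ 8 * exp (4 * kappa_E E \<theta>) * max 1 (kappa n \<theta>) \<and>
           real L \<ge> 16 * (10 ^ 6 * (1 + c_rho))\<^sup>2 * max 1 (kappa n \<theta>) * exp (4 * kappa_E E \<theta>) * real n / (ln (real n))\<^sup>2
           \<longrightarrow>
           Linf_norm n (\<lambda>i. reg_mle n L (rho c_rho n L \<theta> E) E y i - \<theta> i)
             \<le> 10 ^ 6 * (1 + c_rho) * (exp (2 * kappa_E E \<theta>) * sqrt (1 / (real n * p\<^sup>2 * real L))
                        + exp (kappa_E E \<theta>) * sqrt (ln (real n) / (real n * p * real L))) \<and>
           L2_set (\<lambda>i. reg_mle n L (rho c_rho n L \<theta> E) E y i - \<theta> i) {1..n}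
             \<le> 13824 * (1 + c_rho) * (exp (kappa_E E \<theta>) * sqrt (1 / (p * real L)))}"
  have ln0: "ln (real n) \<ge> 0" using n by simp
  have D: "3 * (real n * p) > 0" using np ln0 by linarith
  have "measure_pmf.prob (btl_data n p L \<theta>) (- ?T)
      \<le> measure_pmf.prob (erdos_renyi n p) {E. \<not> expanding n p E} + 258 / real n ^ 4"
    unfolding btl_data_def
  proof (rule prob_bind_pmf_le)
    fix E assume "E \<notin> {E. \<not> expanding n p E}"
    hence ex: "expanding n p E" by simp
    let ?good = "\<lambda>y. (\<forall>i\<in>{1..n}. \<bar>score n E (ybar L y) \<theta> i\<bar> \<le> sqrt (5 * (3 * (real n * p)) * ln (real n) / real L))
          \<and> (\<Sum>i = 1..n. (score n E (ybar L y) \<theta> i)\<^sup>2) \<le> 4 * real n * (3 * (real n * p)) / real L"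
    have "(E, y) \<in> ?T" if "?good y" for y
      using reg_mle_error_bound[OF assms n L \<theta> \<kappa> p(1) np ex, of y] that by auto
    hence "Pair E -` (- ?T) \<subseteq> {y. \<not> ?good y}" by blast
    hence "measure_pmf.prob (map_pmf (Pair E) (btl_outcomes n L \<theta> E)) (- ?T)
       \<le> measure_pmf.prob (btl_outcomes n L \<theta> E) {y. \<not> ?good y}"
      by (simp only: measure_map_pmf) (rule measure_pmf.finite_measure_mono, auto)
    also have "\<dots> \<le> 258 / real n ^ 4"
      by (rule score_tail[OF n L D expandingD(3)[OF ex]])
    finally show "measure_pmf.prob (map_pmf (Pair E) (btl_outcomes n L \<theta> E)) (- ?T) \<le> 258 / real n ^ 4" .
  qed simp
  also have "measure_pmf.prob (erdos_renyi n p) {E. \<not> expanding n p E} \<le> 3 / real n ^ 4"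
    by (rule erdos_renyi_expanding[OF n p]) (use np in simp)
  also have "3 / real n ^ 4 + 258 / real n ^ 4 = 261 / real n ^ 4" by (simp add: add_divide_distrib[symmetric])
  finally have "measure_pmf.prob (btl_data n p L \<theta>) (- ?T) \<le> 261 / real n ^ 4" by simp
  moreover have "measure_pmf.prob (btl_data n p L \<theta>) (- ?T) = 1 - measure_pmf.prob (btl_data n p L \<theta>) ?T"
    using measure_pmf.prob_compl[of ?T "btl_data n p L \<theta>"] by (simp add: Compl_eq_Diff_UNIV)
  ultimately show "measure_pmf.prob (btl_data n p L \<theta>) ?T \<ge> 1 - 261 / real n ^ 4" by linarith
qed


end
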